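(* Let $\varepsilon>0$ be a constant. There exists a dynamic streaming tester for $1$-edge connectivity (i.e., connectivity) of graphs on vertex set $[n]$ that uses $\tilde{O}(n^{1-\varepsilon})$ space and post-processing time.
   Context: In the dynamic streaming model, the input graph on the fixed vertex set $[n]$ is defined by a sequence of edge insertions and deletions. For a graph property $\Pi$, a graph $G$ with $m$ edges is $\varepsilon$-far from having $\Pi$ if one has to modify (insert or delete) more than $\varepsilon m$ edges of $G$ to obtain a graph having $\Pi$. A dynamic streaming tester for $\Pi$ is an algorithm that makes a single pass over a stream of edge insertions and deletions and, with probability at least $2/3$, accepts every graph satisfying $\Pi$ and rejects every graph that is $\varepsilon$-far from having $\Pi$. Post-processing time is the time needed after the stream ends to produce the output. $\tilde{O}(g)$ hides $\mathrm{poly}\log$ factors (here $\mathrm{poly}\log n$).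
   Formalization: The bound n^(1-ε) is read as max(1, n^(1-ε)); this changes nothing for ε ≤ 1, while for ε > 1 the literal bound tends to 0 and no tester can use less than one bit of space and one step of time. *)

theory Defs
  imports "HOL-Probability.Probability" "HOL-Library.Landau_Symbols" "HOL-Library.Log_Nat"
begin

text \<open>A graph on the vertex set $[n]$ is given by its set of edges, each edge being a
  two-element subset of \<open>{1..n}\<close>.\<close>

definition edges_on :: "nat \<Rightarrow> nat set set" where
  "edges_on n = {{u, v} | u v. u \<in> {1..n} \<and> v \<in> {1..n} \<and> u \<noteq> v}"

definition connected_graph :: "nat \<Rightarrow> nat set set \<Rightarrow> bool" where
  "connected_graph n E \<longleftrightarrow> (\<forall>u\<in>{1..n}. \<forall>v\<in>{1..n}. (u, v) \<in> {(x, y). {x, y} \<in> E}\<^sup>*)"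

text \<open>The number of edge insertions and deletions that turn one edge set into another is the
  size of their symmetric difference.\<close>

definition far_from :: "(nat \<Rightarrow> nat set set \<Rightarrow> bool) \<Rightarrow> real \<Rightarrow> nat \<Rightarrow> nat set set \<Rightarrow> bool" where
  "far_from P \<epsilon> n E \<longleftrightarrow>
     (\<forall>E'. E' \<subseteq> edges_on n \<longrightarrow> P n E' \<longrightarrow> real (card ((E - E') \<union> (E' - E))) > \<epsilon> * real (card E))"

datatype edge_update = Insert nat nat | Delete nat nat

text \<open>The streamed graph stays simple: only absent edges are inserted and only present edges
  are deleted. The end points of an edge may be presented in either order.\<close>

fun valid_stream_from :: "nat \<Rightarrow> nat set set \<Rightarrow> edge_update list \<Rightarrow> bool" where
  "valid_stream_from n E [] \<longleftrightarrow> True"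
| "valid_stream_from n E (Insert u v # xs) \<longleftrightarrow>
     {u, v} \<in> edges_on n \<and> {u, v} \<notin> E \<and> valid_stream_from n (insert {u, v} E) xs"
| "valid_stream_from n E (Delete u v # xs) \<longleftrightarrow>
     {u, v} \<in> E \<and> valid_stream_from n (E - {{u, v}}) xs"

abbreviation valid_stream :: "nat \<Rightarrow> edge_update list \<Rightarrow> bool" where
  "valid_stream n xs \<equiv> valid_stream_from n {} xs"

fun apply_update :: "edge_update \<Rightarrow> nat set set \<Rightarrow> nat set set" where
  "apply_update (Insert u v) E = insert {u, v} E"
| "apply_update (Delete u v) E = E - {{u, v}}"

definition stream_graph :: "edge_update list \<Rightarrow> nat set set" where
  "stream_graph xs = fold apply_update xs {}"

text \<open>Algorithms are while-programs for a randomized word RAM with \<open>S\<close> memory words of \<open>w\<close> bits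
  each. Every value computed by an expression is reduced modulo \<open>2 ^ w\<close>; all data, including
  loop counters and stored random choices, live in the \<open>S\<close> words.\<close>

type_synonym memory = "nat \<Rightarrow> nat"

datatype binop = Plus | Minus | Times | Div | Mod | Less | Equal

datatype aexp = Const nat | Load aexp | Binop binop aexp aexp

fun eval_op :: "binop \<Rightarrow> nat \<Rightarrow> nat \<Rightarrow> nat" where
  "eval_op Plus x y = x + y"
| "eval_op Minus x y = x - y"
| "eval_op Times x y = x * y"
| "eval_op Div x y = x div y"
| "eval_op Mod x y = x mod y"
| "eval_op Less x y = (if x < y then 1 else 0)"
| "eval_op Equal x y = (if x = y then 1 else 0)"

fun eval :: "nat \<Rightarrow> aexp \<Rightarrow> memory \<Rightarrow> nat" where
  "eval w (Const k) m = k mod 2 ^ w"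
| "eval w (Load a) m = m (eval w a m)"
| "eval w (Binop f a b) m = eval_op f (eval w a m) (eval w b m) mod 2 ^ w"

text \<open>\<open>Store a e\<close> writes the value of \<open>e\<close> to the cell whose address is the value of \<open>a\<close>;
  \<open>Rand a e\<close> writes there a uniformly random number between 0 and the value of \<open>e\<close>, inclusive.\<close>

datatype com =
    Skip
  | Store aexp aexp
  | Rand aexp aexp
  | Seq com com
  | Cond aexp com com
  | While aexp com

text \<open>One time step. An attempt to write outside the \<open>S\<close> available words blocks, so that a program
  that halts has respected the space bound. Cells outside are never written and contain 0.
  Expressions in a program have constant size, so evaluating one is part of a single step.\<close>

primrec step :: "nat \<Rightarrow> nat \<Rightarrow> com \<Rightarrow> memory \<Rightarrow> (com \<times> memory) pmf" where
  "step w S Skip m = return_pmf (Skip, m)"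
| "step w S (Store a e) m =
     (if eval w a m < S then return_pmf (Skip, m(eval w a m := eval w e m))
      else return_pmf (Store a e, m))"
| "step w S (Rand a e) m =
     (if eval w a m < S
      then map_pmf (\<lambda>x. (Skip, m(eval w a m := x))) (pmf_of_set {..eval w e m})
      else return_pmf (Rand a e, m))"
| "step w S (Seq c d) m =
     (if c = Skip then return_pmf (d, m)
      else map_pmf (\<lambda>(c', m'). (Seq c' d, m')) (step w S c m))"
| "step w S (Cond e c d) m = return_pmf (if eval w e m \<noteq> 0 then c else d, m)"
| "step w S (While e c) m =
     return_pmf (if eval w e m \<noteq> 0 then Seq c (While e c) else Skip, m)"

primrec steps :: "nat \<Rightarrow> nat \<Rightarrow> nat \<Rightarrow> com \<times> memory \<Rightarrow> (com \<times> memory) pmf" where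
  "steps w S 0 cm = return_pmf cm"
| "steps w S (Suc t) cm = bind_pmf (step w S (fst cm) (snd cm)) (steps w S t)"

definition halts_within :: "nat \<Rightarrow> nat \<Rightarrow> nat \<Rightarrow> com \<Rightarrow> memory \<Rightarrow> bool" where
  "halts_within w S t c m \<longleftrightarrow> (\<forall>cm \<in> set_pmf (steps w S t (c, m)). fst cm = Skip)"

text \<open>Only meaningful if \<open>c\<close> halts within some number of steps for all random choices; the number of
  steps taken is then immaterial, as halted configurations do not change.\<close>

definition outcome :: "nat \<Rightarrow> nat \<Rightarrow> com \<Rightarrow> memory \<Rightarrow> memory pmf" where
  "outcome w S c m = map_pmf snd (steps w S (LEAST t. halts_within w S t c m) (c, m))"

text \<open>A streaming algorithm is a fixed program for all \<open>n\<close>: an initialization, a routine executed once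
  for each stream element in order, and the post-processing. Words have \<open>\<Theta>(log n)\<close> bits;
  \<open>floorlog 2 n\<close> is the length of the binary representation of \<open>n\<close>.\<close>

record stream_alg =
  word_factor :: nat
  init_prog :: com
  update_prog :: com
  post_prog :: com

definition word_size :: "stream_alg \<Rightarrow> nat \<Rightarrow> nat" where
  "word_size A n = word_factor A * floorlog 2 n"

text \<open>Cell 0 initially holds \<open>n\<close>; cells 1 to 3 receive each stream element.\<close>

definition start_memory :: "nat \<Rightarrow> memory" where
  "start_memory n = (\<lambda>_. 0)(0 := n)"

fun feed :: "edge_update \<Rightarrow> memory \<Rightarrow> memory" where
  "feed (Insert u v) m = m(1 := 1, 2 := u, 3 := v)"
| "feed (Delete u v) m = m(1 := 0, 2 := u, 3 := v)"

definition memory_after :: "stream_alg \<Rightarrow> nat \<Rightarrow> nat \<Rightarrow> edge_update list \<Rightarrow> memory pmf" where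
  "memory_after A S n xs =
     foldl (\<lambda>p x. bind_pmf p (\<lambda>m. outcome (word_size A n) S (update_prog A) (feed x m)))
       (outcome (word_size A n) S (init_prog A) (start_memory n)) xs"

text \<open>Cell 0 holds the verdict at the end; nonzero means accept.\<close>

definition verdict :: "stream_alg \<Rightarrow> nat \<Rightarrow> nat \<Rightarrow> edge_update list \<Rightarrow> bool pmf" where
  "verdict A S n xs =
     bind_pmf (memory_after A S n xs)
       (\<lambda>m. map_pmf (\<lambda>m'. m' 0 \<noteq> 0) (outcome (word_size A n) S (post_prog A) m))"

text \<open>On streams over \<open>n\<close> vertices the algorithm works with \<open>S\<close> words and takes at most \<open>T\<close>
  post-processing steps, for all outcomes of its random choices. The memory has to
  contain the four interface cells.\<close>

definition runs_within :: "stream_alg \<Rightarrow> nat \<Rightarrow> nat \<Rightarrow> nat \<Rightarrow> bool" where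
  "runs_within A n S T \<longleftrightarrow>
     4 \<le> S \<and> 0 < word_factor A \<and>
     (\<exists>t. halts_within (word_size A n) S t (init_prog A) (start_memory n)) \<and>
     (\<forall>xs x. valid_stream n (xs @ [x]) \<longrightarrow> (\<forall>m \<in> set_pmf (memory_after A S n xs).
        \<exists>t. halts_within (word_size A n) S t (update_prog A) (feed x m))) \<and>
     (\<forall>xs. valid_stream n xs \<longrightarrow> (\<forall>m \<in> set_pmf (memory_after A S n xs).
        halts_within (word_size A n) S T (post_prog A) m))"

definition dynamic_streaming_tester ::
  "(nat \<Rightarrow> nat set set \<Rightarrow> bool) \<Rightarrow> real \<Rightarrow> stream_alg \<Rightarrow> (nat \<Rightarrow> nat) \<Rightarrow> (nat \<Rightarrow> nat) \<Rightarrow> bool" where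
  "dynamic_streaming_tester P \<epsilon> A S T \<longleftrightarrow>
     (\<forall>n\<ge>1. runs_within A n (S n) (T n) \<and>
        (\<forall>xs. valid_stream n xs \<longrightarrow>
           (P n (stream_graph xs) \<longrightarrow> pmf (verdict A (S n) n xs) True \<ge> 2 / 3) \<and>
           (far_from P \<epsilon> n (stream_graph xs) \<longrightarrow> pmf (verdict A (S n) n xs) False \<ge> 2 / 3)))"

definition space_bits :: "stream_alg \<Rightarrow> (nat \<Rightarrow> nat) \<Rightarrow> nat \<Rightarrow> nat" where
  "space_bits A S n = S n * word_size A n"

definition soft_O :: "(nat \<Rightarrow> real) \<Rightarrow> (nat \<Rightarrow> real) set" where
  "soft_O g = {f. \<exists>k::nat. f \<in> O(\<lambda>n. g n * ln (real n) ^ k)}"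

end

theory Submission
  imports Defs
begin

text \<open>
  If a graph with at least \<open>n - 1\<close> edges is \<open>\<epsilon>\<close>-far from connected, then it has more than \<open>\<epsilon> n\<close>
  components, hence \<open>\<Omega>(n)\<close> components of size at most \<open>k = \<lfloor>1/\<epsilon>\<rfloor>\<close>. The vertices are divided into blocks
  of length \<open>q \<approx> n powr (1/k)\<close>, up to a constant factor, and from each block one uniformly random
  vertex is drawn for each of \<open>k\<close> colours, independently in each of \<open>M\<close> groups. A component of size
  \<open>s \<le> k\<close> is caught by a group, its \<open>b\<close>-th vertex having colour \<open>b\<close> and no other one, with
  probability about \<open>q powr (-s)\<close>. Vertices in different blocks are drawn independently and vertices of
  one block exclude each other, so the second moment method shows that some component is caught with
  probability at least \<open>2/3\<close>.

  For each sampled vertex a linear sketch records its degree and, for each colour, the sum of \<open>n + v\<close>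
  over its neighbours \<open>v\<close> sampled with that colour; this sum tells whether there is exactly one such
  neighbour, and which. A caught component is recovered from its vertex of colour 0 by exploration. That
  a recovered set has no outgoing edges is certified by comparing degrees, so a connected graph is never
  rejected.
\<close>

section \<open>Execution of programs\<close>

lemma steps_Skip: "steps w S t (Skip, m) = return_pmf (Skip, m)"
  by (induction t) (auto simp: bind_return_pmf)

lemma steps_add: "steps w S (s + t) cm = bind_pmf (steps w S s cm) (steps w S t)"
proof (induction s arbitrary: cm)
  case (Suc s)
  have "steps w S (s + t) = (\<lambda>cm. bind_pmf (steps w S s cm) (steps w S t))"
    by (rule ext) (rule Suc)
  then show ?case by (simp add: bind_assoc_pmf)
qed (simp add: bind_return_pmf)

lemma steps_halted:
  assumes "halts_within w S s c m" "s \<le> t"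
  shows "steps w S t (c, m) = steps w S s (c, m)"
proof -
  have "steps w S t (c, m) = bind_pmf (steps w S s (c, m)) (steps w S (t - s))"
    using assms(2) steps_add[of w S s "t - s"] by simp
  also have "\<dots> = bind_pmf (steps w S s (c, m)) return_pmf"
    using assms(1) by (intro bind_pmf_cong) (auto simp: halts_within_def steps_Skip)
  finally show ?thesis by (simp add: bind_return_pmf')
qed

lemma steps_Seq:
  assumes "halts_within w S s c m"
    and "\<And>cm. cm \<in> set_pmf (steps w S s (c, m)) \<Longrightarrow> halts_within w S t d (snd cm)"
  shows "steps w S (s + t + 1) (Seq c d, m) =
    bind_pmf (steps w S s (c, m)) (\<lambda>cm. steps w S t (d, snd cm))"
  using assms
proof (induction s arbitrary: c m)
  case 0
  then have "c = Skip" by (simp add: halts_within_def)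
  then show ?case by (simp add: bind_return_pmf)
next
  case (Suc s)
  show ?case
  proof (cases "c = Skip")
    case True
    then have "steps w S (Suc s + t) (d, m) = steps w S t (d, m)"
      using Suc.prems(2) by (intro steps_halted) (simp_all add: steps_Skip del: steps.simps)
    then show ?thesis using True by (simp add: bind_return_pmf steps_Skip)
  next
    case False
    have IH: "steps w S (s + t + 1) (Seq (fst cm) d, snd cm) =
        bind_pmf (steps w S s cm) (\<lambda>cm. steps w S t (d, snd cm))"
      if "cm \<in> set_pmf (step w S c m)" for cm
    proof -
      have reach: "set_pmf (steps w S s cm) \<subseteq> set_pmf (steps w S (Suc s) (c, m))"
        using that by auto
      then have "halts_within w S s (fst cm) (snd cm)"
        using Suc.prems(1) unfolding halts_within_def prod.collapse by blast
      then show ?thesis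
        using Suc.IH[of "fst cm" "snd cm"] Suc.prems(2) reach unfolding prod.collapse by blast
    qed
    have "steps w S (Suc s + t + 1) (Seq c d, m) =
        bind_pmf (step w S c m) (\<lambda>cm. steps w S (s + t + 1) (Seq (fst cm) d, snd cm))"
      using False by (simp add: bind_map_pmf case_prod_beta)
    also have "\<dots> = bind_pmf (step w S c m)
        (\<lambda>cm. bind_pmf (steps w S s cm) (\<lambda>cm. steps w S t (d, snd cm)))"
      by (intro bind_pmf_cong refl IH)
    finally show ?thesis by (simp add: bind_assoc_pmf)
  qed
qed

text \<open>A run is described by a coupling of its final memory with an auxiliary random variable of
  distribution \<open>p\<close>; \<open>ensures\<close> is the case of a trivial variable, an ordinary total-correctness triple.\<close>

definition realizes ::
  "nat \<Rightarrow> nat \<Rightarrow> nat \<Rightarrow> com \<Rightarrow> memory \<Rightarrow> 'a pmf \<Rightarrow> ('a \<Rightarrow> memory \<Rightarrow> bool) \<Rightarrow> bool" where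
  "realizes w S t c m p R \<longleftrightarrow>
     rel_pmf (\<lambda>x cm. fst cm = Skip \<and> R x (snd cm)) p (steps w S t (c, m))"

abbreviation ensures ::
  "nat \<Rightarrow> nat \<Rightarrow> nat \<Rightarrow> com \<Rightarrow> memory \<Rightarrow> (memory \<Rightarrow> bool) \<Rightarrow> bool" where
  "ensures w S t c m Q \<equiv> realizes w S t c m (return_pmf ()) (\<lambda>_. Q)"

lemma realizes_halts: "realizes w S t c m p R \<Longrightarrow> halts_within w S t c m"
  unfolding realizes_def halts_within_def by (blast dest: rel_setD2[OF rel_pmf_imp_rel_set])

lemma realizes_outcome:
  assumes "realizes w S t c m p R"
  shows "rel_pmf R p (outcome w S c m)"
proof -
  define l where "l = (LEAST t. halts_within w S t c m)"
  have "halts_within w S l c m" "l \<le> t"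
    unfolding l_def using realizes_halts[OF assms] by (auto intro: LeastI Least_le)
  then have "outcome w S c m = map_pmf snd (steps w S t (c, m))"
    unfolding outcome_def l_def[symmetric] by (simp only: steps_halted[of w S l c m t])
  then show ?thesis
    using assms unfolding realizes_def by (simp add: pmf.rel_map) (erule pmf.rel_mono_strong, simp)
qed

lemma realizes_return_pmf: "realizes w S t c m (return_pmf x) R \<longleftrightarrow> ensures w S t c m (R x)"
  by (simp add: realizes_def rel_pmf_return_pmf1)

lemma realizes_mono:
  assumes "realizes w S s c m p R" "s \<le> t" "\<And>x m'. R x m' \<Longrightarrow> R' x m'"
  shows "realizes w S t c m p R'"
  using assms(1) unfolding realizes_def steps_halted[OF realizes_halts[OF assms(1)] assms(2)]
  by (rule pmf.rel_mono_strong) (simp add: assms(3))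

lemma ensures_Skip: "Q m \<Longrightarrow> ensures w S 0 Skip m Q"
  by (simp add: realizes_def)

lemma ensures_Store:
  assumes "eval w a m < S" "Q (m(eval w a m := eval w e m))"
  shows "ensures w S 1 (Store a e) m Q"
  using assms by (simp add: realizes_def bind_return_pmf)

lemma realizes_Rand:
  assumes "eval w a m < S" "\<And>y. y \<le> eval w e m \<Longrightarrow> R (f y) (m(eval w a m := y))"
  shows "realizes w S 1 (Rand a e) m (map_pmf f (pmf_of_set {..eval w e m})) R"
proof -
  have "steps w S 0 = return_pmf" by (rule ext) simp
  then show ?thesis
    using assms by (auto simp: realizes_def bind_return_pmf' pmf.rel_map intro: rel_pmf_reflI)
qed

lemma realizes_Seq:
  assumes c: "realizes w S s c m p R" and d: "\<And>x m'. R x m' \<Longrightarrow> realizes w S t d m' (f x) R'"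
  shows "realizes w S (s + t + 1) (Seq c d) m (bind_pmf p f) R'"
proof -
  have "halts_within w S t d (snd cm)" if "cm \<in> set_pmf (steps w S s (c, m))" for cm
    using rel_setD2[OF rel_pmf_imp_rel_set[OF c[unfolded realizes_def]] that] d realizes_halts
    by blast
  then show ?thesis
    unfolding realizes_def
    by (subst steps_Seq[OF realizes_halts[OF c]])
      (use d in \<open>auto simp: realizes_def intro: rel_pmf_bindI[OF c[unfolded realizes_def]]\<close>)
qed

lemma ensures_Seq:
  assumes "ensures w S s c m R" "\<And>m'. R m' \<Longrightarrow> ensures w S t d m' Q"
  shows "ensures w S (s + t + 1) (Seq c d) m Q"
  using realizes_Seq[OF assms(1), of t d "\<lambda>_. return_pmf ()"] assms(2)
  by (simp add: bind_return_pmf)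

primrec iterate_pmf :: "(nat \<Rightarrow> 'a \<Rightarrow> 'a pmf) \<Rightarrow> nat \<Rightarrow> 'a \<Rightarrow> 'a pmf" where
  "iterate_pmf f 0 x = return_pmf x"
| "iterate_pmf f (Suc d) x = bind_pmf (f 0 x) (iterate_pmf (\<lambda>i. f (Suc i)) d)"

lemma iterate_pmf_Suc: "iterate_pmf f (Suc d) x = bind_pmf (iterate_pmf f d x) (f d)"
proof (induction d arbitrary: f x)
  case 0
  have "iterate_pmf f 0 = return_pmf" for f :: "nat \<Rightarrow> 'a \<Rightarrow> 'a pmf" by (rule ext) simp
  then show ?case by (simp add: bind_return_pmf bind_return_pmf')
next
  case (Suc d)
  have "iterate_pmf (\<lambda>i. f (Suc i)) (Suc d) =
      (\<lambda>y. bind_pmf (iterate_pmf (\<lambda>i. f (Suc i)) d y) (f (Suc d)))"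
    by (rule ext) (rule Suc)
  then show ?case by (subst iterate_pmf.simps(2)) (simp only: iterate_pmf.simps(2) bind_assoc_pmf)
qed

lemma iterate_pmf_Pi_pmf:
  "iterate_pmf (\<lambda>i \<rho>. map_pmf (\<lambda>y. \<rho>(i := y)) (p i)) d (\<lambda>_. dflt) = Pi_pmf {..<d} dflt p"
proof (induction d)
  case (Suc d)
  have "Pi_pmf {..<Suc d} dflt p =
      bind_pmf (p d) (\<lambda>y. bind_pmf (Pi_pmf {..<d} dflt p) (\<lambda>\<rho>. return_pmf (\<rho>(d := y))))"
    by (simp add: lessThan_Suc Pi_pmf_insert')
  also have "\<dots> = bind_pmf (Pi_pmf {..<d} dflt p) (\<lambda>\<rho>. map_pmf (\<lambda>y. \<rho>(d := y)) (p d))"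
    by (subst bind_commute_pmf) (simp add: map_pmf_def)
  finally show ?case by (simp only: iterate_pmf_Suc Suc)
qed simp

lemma realizes_While:
  assumes "\<And>i x m. i < d \<Longrightarrow> R i x m \<Longrightarrow> eval w e m \<noteq> 0"
    and "\<And>i x m. i < d \<Longrightarrow> R i x m \<Longrightarrow> realizes w S s c m (f i x) (R (Suc i))"
    and "\<And>x m. R d x m \<Longrightarrow> eval w e m = 0" and "R 0 x m"
  shows "realizes w S (d * (s + 2) + 1) (While e c) m (iterate_pmf f d x) (R d)"
  using assms
proof (induction d arbitrary: R f x m)
  case 0
  then show ?case by (simp add: realizes_def bind_return_pmf)
next
  case (Suc d)
  have rest: "realizes w S (d * (s + 2) + 1) (While e c) m'
      (iterate_pmf (\<lambda>i. f (Suc i)) d x') (R (Suc d))"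
    if "R (Suc 0) x' m'" for x' m'
    by (rule Suc.IH[of "\<lambda>i. R (Suc i)"]) (use Suc.prems that in blast)+
  have "realizes w S s c m (f 0 x) (R (Suc 0))" using Suc.prems(2,4) by blast
  then have "realizes w S (s + (d * (s + 2) + 1) + 1) (Seq c (While e c)) m
      (iterate_pmf f (Suc d) x) (R (Suc d))"
    using rest by (simp only: iterate_pmf.simps) (rule realizes_Seq)
  moreover have "eval w e m \<noteq> 0" using Suc.prems(1,4) by blast
  moreover have "Suc d * (s + 2) + 1 = Suc (s + (d * (s + 2) + 1) + 1)" by simp
  ultimately show ?case by (simp only: realizes_def steps.simps) (simp add: bind_return_pmf)
qed

lemma ensures_While:
  assumes "\<And>i m. i < d \<Longrightarrow> I i m \<Longrightarrow> eval w e m \<noteq> 0"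
    and "\<And>i m. i < d \<Longrightarrow> I i m \<Longrightarrow> ensures w S s c m (I (Suc i))"
    and "\<And>m. I d m \<Longrightarrow> eval w e m = 0" and "I 0 m"
  shows "ensures w S (d * (s + 2) + 1) (While e c) m (I d)"
proof -
  have "iterate_pmf (\<lambda>_ _. return_pmf ()) d () = return_pmf ()"
    by (induction d) (simp_all add: bind_return_pmf)
  then show ?thesis
    using realizes_While[of d "\<lambda>i _. I i" w e S s c "\<lambda>_ _. return_pmf ()"] assms by simp
qed

definition stores :: "(aexp \<times> aexp) list \<Rightarrow> com" where
  "stores ps = foldr (\<lambda>(a, e) c. Seq (Store a e) c) ps Skip"

text \<open>If no store affects the operands of another one, then the stores of a list act as if they were
  executed simultaneously.\<close>

lemma ensures_stores:
  assumes "distinct ps" "inj_on ad (set ps)" "\<And>p. p \<in> set ps \<Longrightarrow> ad p < S"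
    and "\<And>p m'. p \<in> set ps \<Longrightarrow> m' (ad p) = m (ad p) \<Longrightarrow> (\<And>z. z \<notin> ad ` set ps \<Longrightarrow> m' z = m z) \<Longrightarrow>
      eval w (fst (asg p)) m' = ad p \<and> eval w (snd (asg p)) m' = val p"
  shows "ensures w S (2 * length ps) (stores (map asg ps)) m
    (\<lambda>m'. (\<forall>p\<in>set ps. m' (ad p) = val p) \<and> (\<forall>z. z \<notin> ad ` set ps \<longrightarrow> m' z = m z))"
  using assms
proof (induction ps arbitrary: m)
  case Nil
  then show ?case by (simp add: stores_def ensures_Skip)
next
  case (Cons p ps)
  define m1 where "m1 = m(ad p := val p)"
  have fresh: "ad p \<notin> ad ` set ps" using Cons.prems(1,2) by auto
  have "eval w (fst (asg p)) m = ad p" "eval w (snd (asg p)) m = val p"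
    using Cons.prems(4)[of p m] by auto
  then have store_p: "ensures w S 1 (Store (fst (asg p)) (snd (asg p))) m (\<lambda>m'. m' = m1)"
    using Cons.prems(3)[of p] by (intro ensures_Store) (simp_all add: m1_def)
  have store_ps: "ensures w S (2 * length ps) (stores (map asg ps)) m1
      (\<lambda>m'. (\<forall>p\<in>set ps. m' (ad p) = val p) \<and> (\<forall>z. z \<notin> ad ` set ps \<longrightarrow> m' z = m1 z))"
  proof (rule Cons.IH)
    fix p' m' assume p': "p' \<in> set ps" "m' (ad p') = m1 (ad p')"
      and agree: "\<And>z. z \<notin> ad ` set ps \<Longrightarrow> m' z = m1 z"
    show "eval w (fst (asg p')) m' = ad p' \<and> eval w (snd (asg p')) m' = val p'"
    proof (rule Cons.prems(4))
      show "m' (ad p') = m (ad p')" using p' fresh by (metis fun_upd_other imageI m1_def)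
      show "m' z = m z" if "z \<notin> ad ` set (p # ps)" for z
        using agree[of z] that by (auto simp: m1_def)
    qed (use p' in simp)
  qed (use Cons.prems in auto)
  have "ensures w S (1 + 2 * length ps + 1)
      (Seq (Store (fst (asg p)) (snd (asg p))) (stores (map asg ps))) m
      (\<lambda>m'. (\<forall>p\<in>set ps. m' (ad p) = val p) \<and> (\<forall>z. z \<notin> ad ` set ps \<longrightarrow> m' z = m1 z))"
    using store_ps by (intro ensures_Seq[OF store_p]) simp
  then have "ensures w S (2 * length (p # ps))
      (Seq (Store (fst (asg p)) (snd (asg p))) (stores (map asg ps))) m
      (\<lambda>m'. (\<forall>p\<in>set (p # ps). m' (ad p) = val p) \<and> (\<forall>z. z \<notin> ad ` set (p # ps) \<longrightarrow> m' z = m z))"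
    using fresh by (elim realizes_mono) (auto simp: m1_def)
  then show ?case by (simp add: stores_def case_prod_beta)
qed

section \<open>Components of graphs\<close>

definition arcs :: "nat set set \<Rightarrow> (nat \<times> nat) set" where
  "arcs E = {(x, y). {x, y} \<in> E}"

definition reach :: "nat \<Rightarrow> nat set set \<Rightarrow> (nat \<times> nat) set" where
  "reach n E = {(u, v). u \<in> {1..n} \<and> v \<in> {1..n} \<and> (u, v) \<in> (arcs E)\<^sup>*}"

definition graph_components :: "nat \<Rightarrow> nat set set \<Rightarrow> nat set set" where
  "graph_components n E = {1..n} // reach n E"

lemma connected_graph_iff_arcs:
  "connected_graph n E \<longleftrightarrow> (\<forall>u\<in>{1..n}. \<forall>v\<in>{1..n}. (u, v) \<in> (arcs E)\<^sup>*)"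
  by (simp add: connected_graph_def arcs_def)

lemma arcs_commute: "(u, v) \<in> arcs E \<longleftrightarrow> (v, u) \<in> arcs E"
  by (simp add: arcs_def insert_commute)

lemma rtrancl_arcs_sym: "(u, v) \<in> (arcs E)\<^sup>* \<Longrightarrow> (v, u) \<in> (arcs E)\<^sup>*"
  by (meson arcs_commute sym_rtrancl symD symI)

lemma edges_onD:
  assumes "{u, v} \<in> edges_on n"
  shows "u \<in> {1..n}" "v \<in> {1..n}" "u \<noteq> v"
  using assms by (auto simp: edges_on_def doubleton_eq_iff)

lemma finite_edges_on: "finite (edges_on n)"
  by (rule finite_subset[of _ "Pow {1..n}"]) (auto simp: edges_on_def)

lemma card_edges_le:
  assumes "E \<subseteq> edges_on n"
  shows "card E \<le> n * n"
proof -
  have "edges_on n \<subseteq> (\<lambda>(u, v). {u, v}) ` ({1..n} \<times> {1..n})"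
    by (auto simp: edges_on_def image_iff Bex_def)
  then have "E \<subseteq> (\<lambda>(u, v). {u, v}) ` ({1..n} \<times> {1..n})"
    using assms by (rule order.trans[rotated])
  then show ?thesis using surj_card_le[of "{1..n} \<times> {1..n}" E] by simp
qed

lemma arcs_subset: "E \<subseteq> edges_on n \<Longrightarrow> arcs E \<subseteq> {1..n} \<times> {1..n}"
  using edges_onD by (fastforce simp: arcs_def)

lemma arcs_sym_diff:
  "u \<noteq> v \<Longrightarrow> arcs (sym_diff E {{u, v}}) = sym_diff (sym_diff (arcs E) {(u, v)}) {(v, u)}"
  by (auto simp: arcs_def insert_commute doubleton_eq_iff)

text \<open>Every vertex except 1 is joined to a vertex closer to 1, and these edges are distinct.\<close>

lemma connected_graph_card_edges:
  assumes conn: "connected_graph n E" and E: "E \<subseteq> edges_on n"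
  shows "n \<le> card E + 1"
proof (cases "n = 0")
  case False
  define d where "d v = (LEAST t. (1, v) \<in> arcs E ^^ t)" for v
  have d: "(1, v) \<in> arcs E ^^ d v" if "v \<in> {1..n}" for v
  proof -
    have "(1, v) \<in> (arcs E)\<^sup>*"
      using conn that False by (auto simp: connected_graph_iff_arcs)
    then show ?thesis unfolding d_def by (meson LeastI rtrancl_imp_relpow)
  qed
  have "\<exists>u. {v, u} \<in> E \<and> d u < d v" if "v \<in> {2..n}" for v
  proof -
    have "d v \<noteq> 0" using d[of v] that by (intro notI) auto
    then obtain t where t: "d v = Suc t" by (cases "d v") auto
    have "(1, v) \<in> arcs E ^^ Suc t" using d[of v] that unfolding t by simp
    then obtain u where u: "(1, u) \<in> arcs E ^^ t" "(u, v) \<in> arcs E" by (rule relpow_Suc_E)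
    have "d u \<le> t" unfolding d_def using u(1) by (rule Least_le)
    then show ?thesis using u(2) t by (auto simp: arcs_def insert_commute)
  qed
  then obtain p where p: "\<And>v. v \<in> {2..n} \<Longrightarrow> {v, p v} \<in> E \<and> d (p v) < d v" by metis
  have "inj_on (\<lambda>v. {v, p v}) {2..n}"
  proof (rule inj_onI)
    fix v v' assume "v \<in> {2..n}" "v' \<in> {2..n}" "{v, p v} = {v', p v'}"
    then show "v = v'" using p[of v] p[of v'] by (auto simp: doubleton_eq_iff)
  qed
  then have "card {2..n} \<le> card E"
    using p E finite_edges_on
    by (intro card_inj_on_le[of "\<lambda>v. {v, p v}"]) (auto intro: finite_subset)
  then show ?thesis by simp
qed simp

lemma equiv_reach: "equiv {1..n} (reach n E)"
  by (rule equivI) (auto simp: reach_def refl_on_def sym_def trans_def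
      dest: rtrancl_arcs_sym intro: rtrancl_trans)

lemma Union_components: "\<Union> (graph_components n E) = {1..n}"
  unfolding graph_components_def by (rule Union_quotient[OF equiv_reach])

lemma finite_components: "finite (graph_components n E)"
  using Union_components[of n E] by (metis finite_UnionD finite_atLeastAtMost)

lemma disjoint_components: "disjoint (graph_components n E)"
  using quotient_disj[OF equiv_reach] by (fastforce simp: graph_components_def disjoint_def)

lemma component_subset: "C \<in> graph_components n E \<Longrightarrow> C \<subseteq> {1..n}"
  using Union_components by blast

lemma finite_component: "C \<in> graph_components n E \<Longrightarrow> finite C"
  by (rule finite_subset[OF component_subset]) auto

lemma component_nonempty: "C \<in> graph_components n E \<Longrightarrow> C \<noteq> {}"
  unfolding graph_components_def using in_quotient_imp_non_empty[OF equiv_reach] by blast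

lemma card_component_pos: "C \<in> graph_components n E \<Longrightarrow> 0 < card C"
  using component_nonempty finite_component by (simp add: card_gt_0_iff)

lemma component_reach:
  assumes "C \<in> graph_components n E" "u \<in> C" "v \<in> C"
  shows "(u, v) \<in> (arcs E)\<^sup>*"
  using quotient_eq_iff[OF equiv_reach, of C n E C u v] assms
  by (auto simp: graph_components_def reach_def)

lemma component_closed:
  assumes "C \<in> graph_components n E" "E \<subseteq> edges_on n" "u \<in> C" "(u, v) \<in> arcs E"
  shows "v \<in> C"
proof -
  have "(u, v) \<in> reach n E"
    using arcs_subset[OF assms(2)] assms(4) by (auto simp: reach_def)
  then show ?thesis
    using assms(1,3) in_quotient_imp_closed[OF equiv_reach] unfolding graph_components_def by blast
qed

lemma card_component_less:
  assumes "C \<in> graph_components n E" "\<not> connected_graph n E"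
  shows "card C < n"
proof (rule ccontr)
  assume "\<not> card C < n"
  then have "C = {1..n}" using component_subset[OF assms(1)] by (intro card_seteq) auto
  then show False
    using assms component_reach unfolding connected_graph_iff_arcs by blast
qed

lemma sum_card_components: "(\<Sum>C\<in>graph_components n E. card C) = n"
  using card_Union_disjoint[OF _ finite_component, of "graph_components n E"] disjoint_components
  by (simp add: Union_components)

lemma connecting_edges:
  assumes "1 \<le> n"
  obtains F where "F \<subseteq> edges_on n" "connected_graph n (E \<union> F)"
    "card F < card (graph_components n E)"
proof -
  define Q where "Q = graph_components n E"
  define rep where "rep C = (SOME v. v \<in> C)" for C :: "nat set"
  have rep: "rep C \<in> C" "rep C \<in> {1..n}" if "C \<in> Q" for C
  proof -
    show "rep C \<in> C"
      using component_nonempty that unfolding Q_def rep_def by (simp add: some_in_eq)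
    then show "rep C \<in> {1..n}" using component_subset that unfolding Q_def by blast
  qed
  obtain C0 where C0: "C0 \<in> Q" using Union_components[of n E] assms unfolding Q_def by fastforce
  define F where "F = (\<lambda>C. {rep C0, rep C}) ` (Q - {C0})"
  have "rep C \<noteq> rep C0" if "C \<in> Q" "C \<noteq> C0" for C
    using rep(1) C0 that disjoint_components[of n E] unfolding Q_def disjoint_def
    by (metis disjoint_iff)
  then have F: "F \<subseteq> edges_on n"
    using rep(2) C0 unfolding F_def edges_on_def by blast
  have to_root: "(u, rep C0) \<in> (arcs (E \<union> F))\<^sup>*" if u: "u \<in> {1..n}" for u
  proof -
    obtain C where C: "C \<in> Q" "u \<in> C" using Union_components[of n E] u unfolding Q_def by blast
    have "(arcs E)\<^sup>* \<subseteq> (arcs (E \<union> F))\<^sup>*" by (intro rtrancl_mono) (auto simp: arcs_def)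
    then have "(u, rep C) \<in> (arcs (E \<union> F))\<^sup>*"
      using component_reach[of C n E u "rep C"] C rep(1) unfolding Q_def by blast
    moreover have "(rep C, rep C0) \<in> (arcs (E \<union> F))\<^sup>="
      using C by (auto simp: arcs_def F_def insert_commute)
    ultimately show ?thesis by (auto intro: rtrancl_into_rtrancl)
  qed
  have "connected_graph n (E \<union> F)"
    unfolding connected_graph_iff_arcs
    by (intro ballI rtrancl_trans[OF to_root rtrancl_arcs_sym[OF to_root]])
  moreover have "card F < card Q"
    using card_image_le[of "Q - {C0}" "\<lambda>C. {rep C0, rep C}"] finite_components[of n E] C0
      psubset_card_mono[of Q "Q - {C0}"] unfolding F_def Q_def by fastforce
  ultimately show ?thesis using that F unfolding Q_def by blast
qed

lemma far_from_connected_components: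
  assumes far: "far_from connected_graph \<epsilon> n E" and E: "E \<subseteq> edges_on n" and n: "1 \<le> n"
  shows "\<epsilon> * real (card E) + 1 < real (card (graph_components n E))"
proof -
  obtain F where F: "F \<subseteq> edges_on n" "connected_graph n (E \<union> F)"
      "card F < card (graph_components n E)"
    using connecting_edges[OF n] .
  have "\<epsilon> * real (card E) < real (card (sym_diff E (E \<union> F)))"
    using far E F(1,2) unfolding far_from_def by blast
  moreover have "card (sym_diff E (E \<union> F)) \<le> card F"
    using finite_subset[OF F(1) finite_edges_on] by (intro card_mono) auto
  ultimately show ?thesis using F(3) by linarith
qed

lemma far_from_not_connected:
  assumes "far_from connected_graph \<epsilon> n E" "E \<subseteq> edges_on n" "0 \<le> \<epsilon>"
  shows "\<not> connected_graph n E"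
proof
  assume "connected_graph n E"
  then have "\<epsilon> * real (card E) < real (card (sym_diff E E))"
    using assms(1,2) unfolding far_from_def by blast
  then show False using assms(3) by (simp add: mult_less_0_iff)
qed

lemma small_components_bound:
  "(k + 1) * card (graph_components n E) \<le> k * card {C \<in> graph_components n E. card C \<le> k} + n"
proof -
  define Q where "Q = graph_components n E"
  have "(k + 1) * card Q = (\<Sum>C\<in>Q. k + 1)" by simp
  also have "\<dots> \<le> (\<Sum>C\<in>Q. (if card C \<le> k then k else 0) + card C)"
    using card_component_pos[of _ n E] by (intro sum_mono) (auto simp: Q_def Suc_le_eq)
  also have "\<dots> = k * card {C \<in> Q. card C \<le> k} + n"
    using sum_card_components[of n E] finite_components[of n E]
    by (simp add: sum.distrib Q_def[symmetric] sum.inter_filter[symmetric])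
  finally show ?thesis by (simp add: Q_def)
qed

lemma many_small_components:
  assumes far: "far_from connected_graph \<epsilon> n E" and E: "E \<subseteq> edges_on n" and n: "1 \<le> n"
    and edges: "n \<le> card E + 1" and \<epsilon>: "0 < \<epsilon>"
  shows "((real k + 1) * \<epsilon> - 1) * real n \<le>
    real k * real (card {C \<in> graph_components n E. card C \<le> k})"
proof -
  define c where "c = card (graph_components n E)"
  have "\<epsilon> * (real n - 1) \<le> \<epsilon> * real (card E)" using edges \<epsilon> by (intro mult_left_mono) auto
  then have c: "\<epsilon> * (real n - 1) + 1 < real c"
    using far_from_connected_components[OF far E n] unfolding c_def by linarith
  have "c \<le> (\<Sum>C\<in>graph_components n E. card C)"
    unfolding c_def card_eq_sum using card_component_pos[of _ n E]
    by (intro sum_mono) (simp add: Suc_le_eq)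
  then have "\<epsilon> * (real n - 1) + 1 < real n" using c by (simp add: sum_card_components)
  then have "\<epsilon> < 1"
    using n mult_right_mono[of 1 \<epsilon> "real n - 1"] by (cases "\<epsilon> < 1") auto
  then have "\<epsilon> * real n \<le> real c" using c by (simp add: algebra_simps)
  then have "(real k + 1) * (\<epsilon> * real n) \<le> (real k + 1) * real c" by (intro mult_left_mono) auto
  also have "\<dots> \<le> real k * real (card {C \<in> graph_components n E. card C \<le> k}) + real n"
    using small_components_bound[of k n E]
    unfolding c_def by (simp flip: of_nat_mult of_nat_add of_nat_Suc add: add.commute)
  finally show ?thesis by (simp add: algebra_simps)
qed

lemma closed_set_not_connected:
  assumes "U \<noteq> {}" "U \<subseteq> {1..n}" "card U < n" "\<And>u v. u \<in> U \<Longrightarrow> (u, v) \<in> arcs E \<Longrightarrow> v \<in> U"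
  shows "\<not> connected_graph n E"
proof
  assume conn: "connected_graph n E"
  obtain u where u: "u \<in> U" using assms(1) by blast
  obtain z where z: "z \<in> {1..n}" "z \<notin> U"
    using assms(3) card_mono[of U "{1..n}"] finite_subset[OF assms(2)] by fastforce
  have "(u, z) \<in> (arcs E)\<^sup>*"
    using conn u z assms(2) unfolding connected_graph_iff_arcs by blast
  then have "z \<in> U" by (induction rule: rtrancl_induct) (use u assms(4) in auto)
  then show False using z by blast
qed

section \<open>Streams of updates\<close>

lemma valid_stream_from_append:
  "valid_stream_from n E (xs @ ys) \<longleftrightarrow>
     valid_stream_from n E xs \<and> valid_stream_from n (fold apply_update xs E) ys"
  by (induction n E xs rule: valid_stream_from.induct) auto

lemma valid_stream_snoc:
  "valid_stream n (xs @ [e]) \<longleftrightarrow> valid_stream n xs \<and> valid_stream_from n (stream_graph xs) [e]"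
  by (simp add: valid_stream_from_append stream_graph_def)

lemma stream_graph_snoc: "stream_graph (xs @ [e]) = apply_update e (stream_graph xs)"
  by (simp add: stream_graph_def)

lemma fold_apply_update_subset:
  "valid_stream_from n E xs \<Longrightarrow> E \<subseteq> edges_on n \<Longrightarrow> fold apply_update xs E \<subseteq> edges_on n"
  by (induction n E xs rule: valid_stream_from.induct) auto

lemma stream_graph_subset: "valid_stream n xs \<Longrightarrow> stream_graph xs \<subseteq> edges_on n"
  unfolding stream_graph_def by (rule fold_apply_update_subset) auto

lemma valid_update_sym_diff:
  assumes "valid_stream_from n E [e]" "E \<subseteq> edges_on n"
  obtains u v where "{u, v} \<in> edges_on n" "apply_update e E = sym_diff E {{u, v}}"
    "\<And>m. feed e m = m(1 := of_bool ({u, v} \<notin> E), 2 := u, 3 := v)"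
proof (cases e)
  case (Insert u v)
  then show ?thesis using assms that[of u v] by auto
next
  case (Delete u v)
  then show ?thesis using assms that[of u v] by auto
qed

section \<open>The second moment method\<close>

lemma (in prob_space) prob_ge_moments:
  fixes X :: "'a \<Rightarrow> real"
  assumes "B \<in> events" "integrable M X" "integrable M (\<lambda>\<omega>. (X \<omega>)\<^sup>2)"
    and supp: "\<And>\<omega>. \<omega> \<in> space M \<Longrightarrow> \<omega> \<notin> B \<Longrightarrow> X \<omega> = 0"
  shows "2 * t * expectation X - t\<^sup>2 * expectation (\<lambda>\<omega>. (X \<omega>)\<^sup>2) \<le> prob B"
proof -
  have "expectation (\<lambda>\<omega>. 2 * t * X \<omega> - t\<^sup>2 * (X \<omega>)\<^sup>2) \<le> expectation (indicator B)"
  proof (rule integral_mono)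
    fix \<omega> assume \<omega>: "\<omega> \<in> space M"
    have "0 \<le> (1 - t * X \<omega>)\<^sup>2" by simp
    then show "2 * t * X \<omega> - t\<^sup>2 * (X \<omega>)\<^sup>2 \<le> indicator B \<omega>"
      using supp[OF \<omega>] by (cases "\<omega> \<in> B") (simp_all add: power2_eq_square algebra_simps)
  qed (use assms in \<open>auto simp: less_top[symmetric]\<close>)
  then show ?thesis using assms by simp
qed

lemma (in prob_space) prob_Union_ge_second_moment:
  assumes I: "finite I" and G: "\<And>c. c \<in> I \<Longrightarrow> G c \<in> events"
    and \<mu>: "\<mu> = (\<Sum>c\<in>I. prob (G c))" "0 < \<mu>" and \<kappa>: "0 \<le> \<kappa>"
    and pair: "\<And>c d. c \<in> I \<Longrightarrow> d \<in> I \<Longrightarrow> c \<noteq> d \<Longrightarrow> prob (G c \<inter> G d) \<le> \<kappa> * prob (G c) * prob (G d)"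
  shows "1 / (1 / \<mu> + \<kappa>) \<le> prob (\<Union>c\<in>I. G c)"
proof -
  define X where "X \<omega> = (\<Sum>c\<in>I. indicator (G c) \<omega> :: real)" for \<omega>
  define t where "t = 1 / (1 + \<kappa> * \<mu>)"
  have \<kappa>\<mu>: "0 \<le> \<kappa> * \<mu>" using \<mu>(2) \<kappa> by simp
  have X2: "(\<lambda>\<omega>. (X \<omega>)\<^sup>2) = (\<lambda>\<omega>. \<Sum>c\<in>I. \<Sum>d\<in>I. indicator (G c \<inter> G d) \<omega>)"
    unfolding X_def power2_eq_square by (simp add: sum_product indicator_inter_arith)
  have GG: "G c \<inter> G d \<in> events" if "c \<in> I" "d \<in> I" for c d using G that by blast
  have EX: "expectation X = \<mu>"
    unfolding X_def \<mu>(1) using G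
    by (subst Bochner_Integration.integral_sum) (auto simp: less_top[symmetric])
  have EX2: "expectation (\<lambda>\<omega>. (X \<omega>)\<^sup>2) = (\<Sum>c\<in>I. \<Sum>d\<in>I. prob (G c \<inter> G d))"
    unfolding X2 using GG by (simp add: Bochner_Integration.integral_sum less_top[symmetric])
  have "integrable M X" "integrable M (\<lambda>\<omega>. (X \<omega>)\<^sup>2)"
    unfolding X2 using G GG
    by (auto simp: X_def[abs_def] less_top[symmetric] intro!: Bochner_Integration.integrable_sum)
  moreover have "(\<Union>c\<in>I. G c) \<in> events" using I G by auto
  ultimately have "2 * t * \<mu> - t\<^sup>2 * expectation (\<lambda>\<omega>. (X \<omega>)\<^sup>2) \<le> prob (\<Union>c\<in>I. G c)"
    unfolding EX[symmetric] by (intro prob_ge_moments) (simp_all add: X_def)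
  moreover have "expectation (\<lambda>\<omega>. (X \<omega>)\<^sup>2) \<le> \<mu> * (1 + \<kappa> * \<mu>)"
  proof -
    have "(\<Sum>c\<in>I. \<Sum>d\<in>I. prob (G c \<inter> G d)) \<le>
        (\<Sum>c\<in>I. \<Sum>d\<in>I. (if d = c then prob (G c) else 0) + \<kappa> * prob (G c) * prob (G d))"
      using pair \<kappa> by (intro sum_mono) auto
    also have "\<dots> = \<mu> * (1 + \<kappa> * \<mu>)"
      using I by (simp add: sum.distrib \<mu>(1) sum_distrib_left sum_distrib_right algebra_simps)
    finally show ?thesis by (simp add: EX2)
  qed
  then have "t\<^sup>2 * expectation (\<lambda>\<omega>. (X \<omega>)\<^sup>2) \<le> t\<^sup>2 * (\<mu> * (1 + \<kappa> * \<mu>))"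
    by (intro mult_left_mono) auto
  moreover have "t * (1 + \<kappa> * \<mu>) = 1" using \<kappa>\<mu> by (simp add: t_def)
  then have "t\<^sup>2 * (\<mu> * (1 + \<kappa> * \<mu>)) = t * \<mu>" by (simp add: power2_eq_square mult_ac)
  moreover have "t * \<mu> = 1 / (1 / \<mu> + \<kappa>)" using \<mu>(2) \<kappa>\<mu> by (simp add: t_def field_simps)
  ultimately show ?thesis by linarith
qed

section \<open>Sampling from blocks\<close>

lemma prob_Pi_pmf_uniform_fixed:
  assumes I: "finite I" "J \<subseteq> I" and A: "finite A" "A \<noteq> {}" and h: "h ` J \<subseteq> A"
  shows "measure_pmf.prob (Pi_pmf I d (\<lambda>_. pmf_of_set A)) {\<rho>. \<forall>j\<in>J. \<rho> j = h j} =
    (1 / real (card A)) ^ card J"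
proof -
  define B where "B j = (if j \<in> J then {h j} else UNIV)" for j
  have "{\<rho>. \<forall>j\<in>J. \<rho> j = h j} = Pi I B" using I(2) by (fastforce simp: B_def Pi_iff)
  then have "measure_pmf.prob (Pi_pmf I d (\<lambda>_. pmf_of_set A)) {\<rho>. \<forall>j\<in>J. \<rho> j = h j} =
      (\<Prod>j\<in>I. measure_pmf.prob (pmf_of_set A) (B j))"
    using I(1) by (simp add: measure_Pi_pmf_Pi)
  also have "\<dots> = (\<Prod>j\<in>I. if j \<in> J then 1 / real (card A) else 1)"
    using A h by (intro prod.cong) (auto simp: B_def measure_pmf_single)
  also have "\<dots> = (1 / real (card A)) ^ card J"
    using I by (subst prod.inter_restrict[symmetric]) (auto simp: Int_absorb1)
  finally show ?thesis .
qed

lemma mult_add_less: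
  fixes i a r N :: nat
  assumes "i < r" "a < N"
  shows "i * N + a < r * N"
proof -
  have "(i + 1) * N \<le> r * N" using assms(1) by (intro mult_le_mono1) simp
  then show ?thesis using assms(2) by simp
qed

lemma mult_add_eq_iff:
  fixes i a i' a' N :: nat
  assumes "a < N" "a' < N"
  shows "i * N + a = i' * N + a' \<longleftrightarrow> i = i' \<and> a = a'"
proof
  assume eq: "i * N + a = i' * N + a'"
  have "(j * N + c) div N = j" if "c < N" for j c using that by simp
  then have "i = i'" using eq assms by metis
  then show "i = i' \<and> a = a'" using eq by simp
qed simp

text \<open>A sample \<open>x\<close> selects a vertex \<open>x i a\<close> from each block \<open>i\<close> of \<open>q\<close> consecutive numbers for each index
  \<open>a = g * k + b\<close> consisting of a group \<open>g < M\<close> and a colour \<open>b < k\<close>. The last block may exceed \<open>n\<close>.\<close>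

locale block_sampling =
  fixes n q k M :: nat
  assumes q_pos: "0 < q"
begin

definition slot :: "nat \<Rightarrow> nat \<Rightarrow> nat" where
  "slot i a = i * (M * k) + a"

definition num_slots :: nat where
  "num_slots = (n div q + 1) * (M * k)"

definition sample :: "(nat \<Rightarrow> nat) \<Rightarrow> nat \<Rightarrow> nat \<Rightarrow> nat" where
  "sample \<rho> i a = i * q + \<rho> (slot i a)"

definition draws :: "(nat \<Rightarrow> nat) pmf" where
  "draws = Pi_pmf {..<num_slots} 0 (\<lambda>_. pmf_of_set {..<q})"

definition samples :: "(nat \<Rightarrow> nat \<Rightarrow> nat) pmf" where
  "samples = map_pmf sample draws"

definition picks :: "(nat \<Rightarrow> nat \<Rightarrow> nat) \<Rightarrow> nat \<times> nat \<Rightarrow> bool" where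
  "picks x = (\<lambda>(v, a). x (v div q) a = v)"

lemma slot_eq_iff: "a < M * k \<Longrightarrow> a' < M * k \<Longrightarrow> slot i a = slot i' a' \<longleftrightarrow> i = i' \<and> a = a'"
  unfolding slot_def by (rule mult_add_eq_iff)

lemma slot_less: "i \<le> n div q \<Longrightarrow> a < M * k \<Longrightarrow> slot i a < num_slots"
  unfolding slot_def num_slots_def by (intro mult_add_less) auto

lemma prob_picks_distinct_slots:
  assumes H: "H \<subseteq> {..n} \<times> {..<M * k}" and inj: "inj_on (\<lambda>(v, a). slot (v div q) a) H"
  shows "measure_pmf.prob samples {x. \<forall>z\<in>H. picks x z} = (1 / real q) ^ card H"
proof -
  define s where "s = (\<lambda>(v, a). slot (v div q) a)"
  define h where "h j = fst (the_inv_into H s j) mod q" for j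
  have inj: "inj_on s H" using inj by (simp add: s_def)
  have s: "s ` H \<subseteq> {..<num_slots}"
    using H by (auto simp: s_def intro!: slot_less div_le_mono)
  have "picks (sample \<rho>) z \<longleftrightarrow> \<rho> (s z) = fst z mod q" for \<rho> z
  proof -
    have "fst z div q * q + \<rho> (s z) = fst z div q * q + fst z mod q \<longleftrightarrow> \<rho> (s z) = fst z mod q"
      by (rule add_left_cancel)
    then show ?thesis by (simp add: picks_def sample_def s_def case_prod_beta)
  qed
  then have "sample -` {x. \<forall>z\<in>H. picks x z} = {\<rho>. \<forall>j\<in>s ` H. \<rho> j = h j}"
    using inj by (auto simp: h_def the_inv_into_f_f)
  moreover have "h ` s ` H \<subseteq> {..<q}" using q_pos by (auto simp: h_def)
  ultimately have "measure_pmf.prob samples {x. \<forall>z\<in>H. picks x z} = (1 / real q) ^ card (s ` H)"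
    using prob_Pi_pmf_uniform_fixed[of "{..<num_slots}" "s ` H" "{..<q}" h 0] s q_pos
    by (simp add: samples_def draws_def lessThan_empty_iff)
  then show ?thesis by (simp add: card_image[OF inj])
qed

text \<open>Two vertices of one block cannot both be picked with the same index, so collisions of slots only
  help.\<close>

lemma prob_picks_le:
  assumes H: "H \<subseteq> {..n} \<times> {..<M * k}"
  shows "measure_pmf.prob samples {x. \<forall>z\<in>H. picks x z} \<le> (1 / real q) ^ card H"
proof (cases "inj_on (\<lambda>(v, a). slot (v div q) a) H")
  case True
  then show ?thesis using prob_picks_distinct_slots[OF H] by simp
next
  case False
  then obtain v a v' a' where va: "(v, a) \<in> H" "(v', a') \<in> H" "(v, a) \<noteq> (v', a')"
    "slot (v div q) a = slot (v' div q) a'"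
    by (auto simp: inj_on_def)
  then have "v div q = v' div q" "a = a'" using slot_eq_iff[of a a'] H by auto
  then have "\<not> (picks x (v, a) \<and> picks x (v', a'))" for x using va(3) by (auto simp: picks_def)
  then have "{x. \<forall>z\<in>H. picks x z} = {}" using va(1,2) by blast
  then show ?thesis by (simp only: measure_empty) simp
qed

definition catches :: "(nat \<Rightarrow> nat \<Rightarrow> nat) \<Rightarrow> nat \<Rightarrow> nat set \<Rightarrow> bool" where
  "catches x g C \<longleftrightarrow> (\<forall>j<card C. \<forall>b<k. picks x (enumerate C j, g * k + b) \<longleftrightarrow> j = b)"

definition targets :: "nat \<Rightarrow> nat set \<Rightarrow> (nat \<times> nat) set" where
  "targets g C = (\<lambda>b. (enumerate C b, g * k + b)) ` {..<card C}"

lemma finite_targets: "finite (targets g C)"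
  by (simp add: targets_def)

lemma card_targets: "card (targets g C) = card C"
  unfolding targets_def by (subst card_image) (auto simp: inj_on_def)

lemma enumerate_eq_iff:
  "finite (C :: nat set) \<Longrightarrow> j < card C \<Longrightarrow> b < card C \<Longrightarrow> enumerate C j = enumerate C b \<longleftrightarrow> j = b"
  using inj_onD[OF bij_betw_imp_inj_on[OF finite_bij_enumerate]] by blast

lemma catches_imp_picks: "catches x g C \<Longrightarrow> card C \<le> k \<Longrightarrow> z \<in> targets g C \<Longrightarrow> picks x z"
  by (auto simp: catches_def targets_def)

lemma targets_subset:
  assumes "g < M" "C \<subseteq> {1..n}" "card C \<le> k"
  shows "targets g C \<subseteq> {..n} \<times> {..<M * k}"
proof
  fix z assume "z \<in> targets g C"
  then obtain b where b: "b < card C" "z = (enumerate C b, g * k + b)" by (auto simp: targets_def)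
  then have "enumerate C b \<in> {1..n}"
    using finite_enumerate_in_set[of C b] finite_subset[OF assms(2)] assms(2) by auto
  then show "z \<in> {..n} \<times> {..<M * k}"
    using b assms(1,3) mult_add_less[of g M b k] by auto
qed

lemma inj_on_slot_targets:
  assumes "g < M" "card C \<le> k"
  shows "inj_on (\<lambda>(v, a). slot (v div q) a) (targets g C)"
proof (rule inj_onI)
  fix z z' assume "z \<in> targets g C" "z' \<in> targets g C"
    and eq: "(\<lambda>(v, a). slot (v div q) a) z = (\<lambda>(v, a). slot (v div q) a) z'"
  then obtain b b' where "b < card C" "z = (enumerate C b, g * k + b)"
    "b' < card C" "z' = (enumerate C b', g * k + b')"
    by (auto simp: targets_def)
  then show "z = z'"
    using eq slot_eq_iff[of "g * k + b" "g * k + b'"] mult_add_less[of g M _ k] assms by auto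
qed

lemma targets_disjoint:
  assumes "finite C" "finite C'" "card C \<le> k" "card C' \<le> k" "g = g' \<Longrightarrow> C \<inter> C' = {}"
  shows "targets g C \<inter> targets g' C' = {}"
proof (rule ccontr)
  assume "targets g C \<inter> targets g' C' \<noteq> {}"
  then obtain b b' where b: "b < card C" "b' < card C'" "g * k + b = g' * k + b'"
    "enumerate C b = enumerate C' b'"
    by (auto simp: targets_def)
  then have "g = g'" using mult_add_eq_iff[of b k b' g g'] assms(3,4) by simp
  then show False
    using assms(1,2,5) b(4) finite_enumerate_in_set[of C b] finite_enumerate_in_set[of C' b'] b(1,2)
    by auto
qed

lemma prob_stray_le:
  assumes C: "g < M" "C \<subseteq> {1..n}" "card C \<le> k" and jb: "j < card C" "b < k" "j \<noteq> b"
  shows "measure_pmf.prob samples {x. \<forall>z\<in>insert (enumerate C j, g * k + b) (targets g C). picks x z}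
    \<le> (1 / real q) ^ (card C + 1)"
proof -
  have fin: "finite C" using C(2) finite_subset by auto
  have "(enumerate C j, g * k + b) \<notin> targets g C"
    using jb enumerate_eq_iff[OF fin] by (auto simp: targets_def)
  moreover have "(enumerate C j, g * k + b) \<in> {..n} \<times> {..<M * k}"
    using finite_enumerate_in_set[OF fin jb(1)] C(1,2) jb(2) mult_add_less by auto
  ultimately show ?thesis
    using prob_picks_le[of "insert (enumerate C j, g * k + b) (targets g C)"] targets_subset[OF C]
    by (simp add: finite_targets card_targets)
qed

lemma prob_catches_ge:
  assumes C: "g < M" "C \<subseteq> {1..n}" "card C \<le> k"
  shows "(1 / real q) ^ card C * (1 - real (k * k) / real q) \<le>
    measure_pmf.prob samples {x. catches x g C}"
proof -
  let ?P = "measure_pmf.prob samples"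
  define J where "J = {(j, b). j < card C \<and> b < k \<and> j \<noteq> b}"
  define Stray where
    "Stray = (\<lambda>(j, b). {x. \<forall>z\<in>insert (enumerate C j, g * k + b) (targets g C). picks x z})"
  have J: "J \<subseteq> {..<k} \<times> {..<k}" using C(3) by (auto simp: J_def)
  then have fin: "finite J" by (rule finite_subset) auto
  have "(1 / real q) ^ card C = ?P {x. \<forall>z\<in>targets g C. picks x z}"
    using prob_picks_distinct_slots[OF targets_subset[OF C] inj_on_slot_targets[OF C(1,3)]]
    by (simp add: card_targets)
  also have "\<dots> \<le> ?P ({x. catches x g C} \<union> (\<Union>p\<in>J. Stray p))"
  proof (rule measure_pmf.finite_measure_mono)
    show "{x. \<forall>z\<in>targets g C. picks x z} \<subseteq> {x. catches x g C} \<union> (\<Union>p\<in>J. Stray p)"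
      by (fastforce simp: catches_def J_def Stray_def targets_def)
  qed simp
  also have "\<dots> \<le> ?P {x. catches x g C} + ?P (\<Union>p\<in>J. Stray p)"
    by (intro measure_Un_le) auto
  also have "?P (\<Union>p\<in>J. Stray p) \<le> (\<Sum>p\<in>J. ?P (Stray p))"
    using fin by (intro measure_UNION_le) auto
  also have "\<dots> \<le> (\<Sum>p\<in>J. (1 / real q) ^ (card C + 1))"
    using prob_stray_le[OF C] by (intro sum_mono) (auto simp: J_def Stray_def simp del: insert_iff)
  also have "\<dots> \<le> real (k * k) * (1 / real q) ^ (card C + 1)"
    using card_mono[OF _ J] unfolding sum_constant by (intro mult_right_mono of_nat_mono) auto
  finally show ?thesis by (simp add: algebra_simps)
qed

lemma prob_catches_both_le:
  assumes "g < M" "C \<subseteq> {1..n}" "card C \<le> k" "g' < M" "C' \<subseteq> {1..n}" "card C' \<le> k"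
    and "g = g' \<Longrightarrow> C \<inter> C' = {}"
  shows "measure_pmf.prob samples ({x. catches x g C} \<inter> {x. catches x g' C'})
    \<le> (1 / real q) ^ card C * (1 / real q) ^ card C'"
proof -
  have "measure_pmf.prob samples ({x. catches x g C} \<inter> {x. catches x g' C'}) \<le>
      measure_pmf.prob samples {x. \<forall>z\<in>targets g C \<union> targets g' C'. picks x z}"
    using catches_imp_picks assms(3,6) by (intro measure_pmf.finite_measure_mono) auto
  also have "\<dots> \<le> (1 / real q) ^ card (targets g C \<union> targets g' C')"
    using targets_subset assms(1-6) by (intro prob_picks_le) simp
  also have "targets g C \<inter> targets g' C' = {}"
    using assms by (intro targets_disjoint) (auto intro: finite_subset)
  then have "card (targets g C \<union> targets g' C') = card C + card C'"
    by (simp add: card_Un_disjoint finite_targets card_targets)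
  finally show ?thesis by (simp add: power_add)
qed

text \<open>By the lower bound on \<open>q\<close>, strays reduce the probability of a catch by a factor of at least \<open>15/16\<close>.
  So the correlation constant of the second moment method is \<open>(16/15)\<^sup>2\<close>, and an expected number of 3
  catches is sufficient.\<close>

lemma prob_catches_ge_const:
  assumes "g < M" "C \<subseteq> {1..n}" "card C \<le> k" and q: "16 * k * k \<le> q"
  shows "15 / 16 * (1 / real q) ^ card C \<le> measure_pmf.prob samples {x. catches x g C}"
proof -
  have "real (16 * k * k) \<le> real q" using q by (rule of_nat_mono)
  then have "15 / 16 \<le> 1 - real (k * k) / real q" using q_pos by (simp add: field_simps)
  then have "15 / 16 * (1 / real q) ^ card C \<le> (1 - real (k * k) / real q) * (1 / real q) ^ card C"
    by (rule mult_right_mono) simp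
  then show ?thesis using prob_catches_ge[OF assms(1-3)] by (simp add: mult.commute)
qed

lemma prob_catches_correlation:
  assumes C: "g < M" "C \<subseteq> {1..n}" "card C \<le> k" and C': "g' < M" "C' \<subseteq> {1..n}" "card C' \<le> k"
    and disj: "g = g' \<Longrightarrow> C \<inter> C' = {}" and q: "16 * k * k \<le> q"
  shows "measure_pmf.prob samples ({x. catches x g C} \<inter> {x. catches x g' C'}) \<le> 256 / 225 *
    measure_pmf.prob samples {x. catches x g C} * measure_pmf.prob samples {x. catches x g' C'}"
proof -
  have "measure_pmf.prob samples ({x. catches x g C} \<inter> {x. catches x g' C'}) \<le>
      (1 / real q) ^ card C * (1 / real q) ^ card C'"
    using C C' disj by (rule prob_catches_both_le)
  also have "\<dots> = 256 / 225 * (15 / 16 * (1 / real q) ^ card C) * (15 / 16 * (1 / real q) ^ card C')"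
    by simp
  also have "\<dots> \<le> 256 / 225 * measure_pmf.prob samples {x. catches x g C} *
      measure_pmf.prob samples {x. catches x g' C'}"
    using prob_catches_ge_const[OF C q] prob_catches_ge_const[OF C' q] by (intro mult_mono) auto
  finally show ?thesis .
qed

lemma prob_exists_catches:
  assumes Q: "finite Q" "disjoint Q" "\<And>C. C \<in> Q \<Longrightarrow> C \<subseteq> {1..n}" "\<And>C. C \<in> Q \<Longrightarrow> card C \<le> k"
    and q: "16 * k * k \<le> q" and large: "16 / 5 * real q ^ k \<le> real M * real (card Q)"
  shows "2 / 3 \<le> measure_pmf.prob samples {x. \<exists>g<M. \<exists>C\<in>Q. catches x g C}"
proof -
  let ?P = "measure_pmf.prob samples"
  define I where "I = {..<M} \<times> Q"
  define G where "G = (\<lambda>(g, C). {x. catches x g C})"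
  define \<mu> where "\<mu> = (\<Sum>i\<in>I. ?P (G i))"
  have pair: "?P (G c \<inter> G d) \<le> 256 / 225 * ?P (G c) * ?P (G d)" if "c \<in> I" "d \<in> I" "c \<noteq> d" for c d
  proof -
    obtain g C g' C' where cd: "c = (g, C)" "d = (g', C')" by (cases c, cases d)
    have "C \<inter> C' = {}" if "g = g'"
      using that \<open>c \<in> I\<close> \<open>d \<in> I\<close> \<open>c \<noteq> d\<close> Q(2) by (simp add: cd I_def disjoint_def)
    then show ?thesis
      using that(1,2) Q(3,4) q unfolding cd I_def G_def
      by (simp only: case_prod_conv) (intro prob_catches_correlation, auto)
  qed
  have lower: "15 / 16 * (1 / real q) ^ k \<le> ?P (G i)" if i: "i \<in> I" for i
  proof -
    have "(1 / real q) ^ k \<le> (1 / real q) ^ card (snd i)"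
      using i Q(4) q_pos by (intro power_decreasing) (auto simp: I_def)
    moreover have "15 / 16 * (1 / real q) ^ card (snd i) \<le> ?P (G i)"
      using prob_catches_ge_const[of "fst i" "snd i"] i Q(3,4) q by (auto simp: I_def G_def)
    ultimately show ?thesis by linarith
  qed
  have "3 * real q ^ k \<le> real M * real (card Q) * (15 / 16)" using large by simp
  then have "3 \<le> real M * real (card Q) * (15 / 16 * (1 / real q) ^ k)"
    using q_pos by (simp add: field_simps power_one_over)
  also have "\<dots> = (\<Sum>i\<in>I. 15 / 16 * (1 / real q) ^ k)"
    by (simp add: I_def card_cartesian_product)
  also have "\<dots> \<le> \<mu>" unfolding \<mu>_def using lower by (rule sum_mono)
  finally have \<mu>3: "3 \<le> \<mu>" .
  have "1 / (1 / \<mu> + 256 / 225) \<le> ?P (\<Union>i\<in>I. G i)"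
    using \<mu>3 pair Q(1)
    by (intro measure_pmf.prob_Union_ge_second_moment[OF _ _ \<mu>_def]) (auto simp: I_def)
  moreover have "2 / 3 \<le> 1 / (1 / \<mu> + 256 / 225)" using \<mu>3 by (simp add: field_simps)
  moreover have "(\<Union>i\<in>I. G i) = {x. \<exists>g<M. \<exists>C\<in>Q. catches x g C}"
    unfolding I_def G_def by fastforce
  ultimately show ?thesis by simp
qed

end

section \<open>Certified exploration\<close>

lemma sum_offset_eq_iff:
  fixes n c :: nat
  assumes "finite T" "\<And>t. t \<in> T \<Longrightarrow> 0 < t" "0 < c" "c \<le> n"
  shows "(\<Sum>t\<in>T. n + t) = n + c \<longleftrightarrow> T = {c}"
proof
  assume eq: "(\<Sum>t\<in>T. n + t) = n + c"
  then obtain y where y: "y \<in> T" using assms(3) by fastforce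
  have "T = {y}"
  proof (rule ccontr)
    assume "T \<noteq> {y}"
    then obtain z where z: "z \<in> T" "z \<noteq> y" using y by blast
    have "(\<Sum>t\<in>{y, z}. n + t) \<le> (\<Sum>t\<in>T. n + t)" using assms(1) y z(1) by (intro sum_mono2) auto
    then show False using eq z(2) assms(2)[OF y] assms(4) by simp
  qed
  then show "T = {c}" using eq by simp
qed simp

lemma relpow_subset_reflcl_relpow: "j \<le> t \<Longrightarrow> R ^^ j \<subseteq> (R\<^sup>=) ^^ t"
proof (induction t arbitrary: j)
  case (Suc t)
  show ?case
  proof (cases "j = Suc t")
    case True
    then show ?thesis using Suc.IH[of t] by auto
  next
    case False
    then have "R ^^ j \<subseteq> (R\<^sup>=) ^^ t" using Suc.prems by (intro Suc.IH) simp
    then show ?thesis by auto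
  qed
qed simp

lemma rtrancl_restrict_closed:
  assumes "(u, v) \<in> R\<^sup>*" "u \<in> C" and closed: "\<And>y z. y \<in> C \<Longrightarrow> (y, z) \<in> R \<Longrightarrow> z \<in> C"
  shows "v \<in> C \<and> (u, v) \<in> (R \<inter> C \<times> C)\<^sup>*"
  using assms(1)
proof (induction rule: rtrancl_induct)
  case (step y z)
  then have "(y, z) \<in> R \<inter> C \<times> C" using closed by blast
  then show ?case using step.IH by (blast intro: rtrancl_into_rtrancl)
qed (simp add: assms(2))

lemma rtrancl_closed_relpow:
  assumes "(u, v) \<in> R\<^sup>*" "u \<in> C" "\<And>y z. y \<in> C \<Longrightarrow> (y, z) \<in> R \<Longrightarrow> z \<in> C"
    and C: "finite C" "card C \<le> k"
  shows "(u, v) \<in> (R\<^sup>=) ^^ (k * k)"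
proof -
  let ?R = "R \<inter> C \<times> C"
  have fin: "finite ?R" using C(1) by simp
  have "(u, v) \<in> ?R\<^sup>*" using rtrancl_restrict_closed[OF assms(1-3)] by (rule conjunct2)
  then obtain j where j: "j \<le> card ?R" "(u, v) \<in> ?R ^^ j"
    unfolding rtrancl_finite_eq_relpow[OF fin] by auto
  have "card ?R \<le> card (C \<times> C)" using C(1) by (intro card_mono) auto
  also have "\<dots> \<le> k * k" using C(2) by (simp add: card_cartesian_product mult_le_mono)
  finally have "?R ^^ j \<subseteq> (?R\<^sup>=) ^^ (k * k)" using j(1) by (intro relpow_subset_reflcl_relpow) simp
  moreover have "(?R\<^sup>=) ^^ t \<subseteq> (R\<^sup>=) ^^ t" for t
  proof (induction t)
    case (Suc t)
    then show ?case unfolding relpow.simps by (intro relcomp_mono) auto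
  qed simp
  ultimately show ?thesis using j(2) by blast
qed

definition first_nonzero :: "nat list \<Rightarrow> nat" where
  "first_nonzero xs = foldr (\<lambda>y z. if y \<noteq> 0 then y else z) xs 0"

lemma first_nonzero_const:
  "(\<And>y. y \<in> set xs \<Longrightarrow> y = 0 \<or> y = c) \<Longrightarrow> first_nonzero xs = (if c \<in> set xs then c else 0)"
  by (induction xs) (fastforce simp: first_nonzero_def)+

lemma first_nonzeroI: "(\<And>y. y \<in> set xs \<Longrightarrow> P y) \<Longrightarrow> P 0 \<Longrightarrow> P (first_nonzero xs)"
  by (induction xs) (auto simp: first_nonzero_def)

context block_sampling
begin

definition colour_sum :: "(nat \<Rightarrow> nat \<Rightarrow> nat) \<Rightarrow> (nat \<times> nat) set \<Rightarrow> nat \<Rightarrow> nat \<Rightarrow> nat \<Rightarrow> nat" where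
  "colour_sum x D g b u = (\<Sum>v | (u, v) \<in> D \<and> picks x (v, g * k + b). n + v)"

definition found :: "(nat \<Rightarrow> nat) \<Rightarrow> nat set" where
  "found c = {b. b < k \<and> c b \<noteq> 0}"

text \<open>Since \<open>c\<close> is injective on the found colours, the equation of cardinalities says that every arc leaving
  a found vertex leads to a found vertex.\<close>

definition certifies :: "(nat \<Rightarrow> nat \<Rightarrow> nat) \<Rightarrow> (nat \<times> nat) set \<Rightarrow> nat \<Rightarrow> (nat \<Rightarrow> nat) \<Rightarrow> bool" where
  "certifies x D g c \<longleftrightarrow> 0 \<in> found c \<and> card (found c) < n \<and> inj_on c (found c) \<and>
     (\<forall>b\<in>found c. picks x (c b, g * k + b) \<and>
        card {v. (c b, v) \<in> D} = card {b' \<in> found c. colour_sum x D g b' (c b) = n + c b'})"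

lemma colour_sum_eq_iff:
  assumes "D \<subseteq> {1..n} \<times> {1..n}" "0 < v" "v \<le> n"
  shows "colour_sum x D g b u = n + v \<longleftrightarrow> {v. (u, v) \<in> D \<and> picks x (v, g * k + b)} = {v}"
  unfolding colour_sum_def
proof (rule sum_offset_eq_iff)
  show "finite {v. (u, v) \<in> D \<and> picks x (v, g * k + b)}"
    by (rule finite_subset[of _ "{1..n}"]) (use assms(1) in auto)
qed (use assms in auto)

lemma certified_closed:
  assumes cert: "certifies x D g c" and D: "D \<subseteq> {1..n} \<times> {1..n}"
    and c: "\<And>b. c b \<le> n" and b: "b \<in> found c"
  shows "{v. (c b, v) \<in> D} \<subseteq> c ` found c"
proof -
  let ?N = "{v. (c b, v) \<in> D}" and ?J = "{b' \<in> found c. colour_sum x D g b' (c b) = n + c b'}"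
  have "c b' \<in> ?N" if "b' \<in> ?J" for b'
  proof -
    have "{v. (c b, v) \<in> D \<and> picks x (v, g * k + b')} = {c b'}"
      using that colour_sum_eq_iff[OF D _ c, of b' x g b' "c b"] by (simp add: found_def)
    then show ?thesis by blast
  qed
  then have "c ` ?J \<subseteq> ?N" by blast
  moreover have "finite ?N" by (rule finite_subset[of _ "{1..n}"]) (use D in auto)
  moreover have "inj_on c ?J" using cert by (auto simp: certifies_def inj_on_def)
  then have "card (c ` ?J) = card ?N" using cert b by (simp add: card_image certifies_def)
  ultimately have "c ` ?J = ?N" by (intro card_subset_eq)
  then show ?thesis by blast
qed

lemma certifies_imp_not_connected:
  assumes cert: "certifies x (arcs E) g c" and E: "E \<subseteq> edges_on n" and c: "\<And>b. c b \<le> n"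
  shows "\<not> connected_graph n E"
proof (rule closed_set_not_connected)
  have fin: "finite (found c)" by (simp add: found_def)
  show "c ` found c \<noteq> {}" using cert by (auto simp: certifies_def)
  show "c ` found c \<subseteq> {1..n}" using c by (auto simp: found_def Suc_le_eq)
  show "card (c ` found c) < n"
    using cert card_image_le[OF fin, of c] by (simp add: certifies_def)
  show "v \<in> c ` found c" if "u \<in> c ` found c" "(u, v) \<in> arcs E" for u v
    using certified_closed[OF cert arcs_subset[OF E] c] that by blast
qed

definition vertex_or_zero :: "nat \<Rightarrow> nat" where
  "vertex_or_zero v = (if v \<le> n then v else 0)"

definition read_neighbour ::
  "(nat \<Rightarrow> nat \<Rightarrow> nat) \<Rightarrow> (nat \<times> nat) set \<Rightarrow> nat \<Rightarrow> nat \<Rightarrow> nat \<Rightarrow> nat \<Rightarrow> nat" where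
  "read_neighbour x D g b b' v =
     (if v = 0 then 0 else vertex_or_zero (colour_sum x D g b (x (v div q) (g * k + b')) - n))"

text \<open>\<open>explore x D g i t b\<close> is the vertex of colour \<open>b\<close> in group \<open>g\<close> found within \<open>t\<close> rounds of
  exploration from the vertex of colour 0 in block \<open>i\<close>, or 0 if there is none. The value is meaningful
  only if the component is caught; \<open>certifies\<close> protects against all others.\<close>

primrec explore ::
  "(nat \<Rightarrow> nat \<Rightarrow> nat) \<Rightarrow> (nat \<times> nat) set \<Rightarrow> nat \<Rightarrow> nat \<Rightarrow> nat \<Rightarrow> nat \<Rightarrow> nat" where
  "explore x D g i 0 = (\<lambda>b. if b = 0 then vertex_or_zero (x i (g * k)) else 0)"
| "explore x D g i (Suc t) = (\<lambda>b. first_nonzero (explore x D g i t b #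
     map (\<lambda>b'. read_neighbour x D g b b' (explore x D g i t b')) [0..<k]))"

definition detects :: "(nat \<Rightarrow> nat \<Rightarrow> nat) \<Rightarrow> (nat \<times> nat) set \<Rightarrow> nat \<Rightarrow> bool" where
  "detects x D i \<longleftrightarrow> (\<exists>g<M. certifies x D g (explore x D g i (k * k)))"

lemma explore_le: "explore x D g i t b \<le> n"
proof (induction t arbitrary: b)
  case (Suc t)
  then show ?case
    unfolding explore.simps
    by (intro first_nonzeroI[where P = "\<lambda>y. y \<le> n"]) (auto simp: read_neighbour_def vertex_or_zero_def)
qed (simp add: vertex_or_zero_def)

lemma detects_imp_not_connected: "detects x (arcs E) i \<Longrightarrow> E \<subseteq> edges_on n \<Longrightarrow> \<not> connected_graph n E"
  unfolding detects_def
  by (elim exE conjE) (rule certifies_imp_not_connected, assumption+, rule explore_le)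

context
  fixes E :: "nat set set" and C :: "nat set" and x :: "nat \<Rightarrow> nat \<Rightarrow> nat" and g :: nat
  assumes E: "E \<subseteq> edges_on n" and C: "C \<in> graph_components n E" and Ck: "card C \<le> k"
    and catches: "catches x g C"
begin

lemma enumerate_component: "j < card C \<Longrightarrow> enumerate C j \<in> C"
  using finite_component[OF C] by (rule finite_enumerate_in_set)

lemma enumerate_component_bounds: "j < card C \<Longrightarrow> 0 < enumerate C j \<and> enumerate C j \<le> n"
  using enumerate_component component_subset[OF C] by fastforce

lemma enumerate_component_surj: "v \<in> C \<Longrightarrow> \<exists>j<card C. v = enumerate C j"
  using bij_betw_imp_surj_on[OF finite_bij_enumerate[OF finite_component[OF C]]] by blast

lemma picks_component: "j < card C \<Longrightarrow> b < k \<Longrightarrow> picks x (enumerate C j, g * k + b) \<longleftrightarrow> j = b"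
  using catches by (simp add: catches_def)

lemma colour_sum_component:
  assumes "j < card C" "b < k"
  shows "colour_sum x (arcs E) g b (enumerate C j) =
    (if b < card C \<and> (enumerate C j, enumerate C b) \<in> arcs E then n + enumerate C b else 0)"
proof -
  have "picks x (v, g * k + b) \<longleftrightarrow> b < card C \<and> v = enumerate C b"
    if v: "(enumerate C j, v) \<in> arcs E" for v
  proof -
    have "v \<in> C" using component_closed[OF C E enumerate_component[OF assms(1)] v] .
    then obtain i where "i < card C" "v = enumerate C i" using enumerate_component_surj by blast
    then show ?thesis
      using picks_component[of i b] assms(2) enumerate_eq_iff[OF finite_component[OF C], of i b]
      by auto
  qed
  then have "{v. (enumerate C j, v) \<in> arcs E \<and> picks x (v, g * k + b)} =
      (if b < card C \<and> (enumerate C j, enumerate C b) \<in> arcs E then {enumerate C b} else {})"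
    by auto
  then show ?thesis by (simp add: colour_sum_def)
qed

definition near :: "nat \<Rightarrow> nat set" where
  "near t = ((arcs E)\<^sup>= ^^ t) `` {enumerate C 0}"

lemma near_Suc: "near (Suc t) = near t \<union> arcs E `` near t"
  by (auto simp: near_def)

lemma near_subset: "near t \<subseteq> C"
  using enumerate_component[OF card_component_pos[OF C]] component_closed[OF C E]
  by (induction t) (auto simp: near_def)

lemma near_square: "near (k * k) = C"
proof
  show "C \<subseteq> near (k * k)"
  proof
    fix v assume "v \<in> C"
    note start = enumerate_component[OF card_component_pos[OF C]]
    have "(enumerate C 0, v) \<in> (arcs E)\<^sup>= ^^ (k * k)"
      using component_reach[OF C start \<open>v \<in> C\<close>] start component_closed[OF C E] finite_component[OF C] Ck
      by (rule rtrancl_closed_relpow)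
    then show "v \<in> near (k * k)" by (simp add: near_def)
  qed
qed (rule near_subset)

lemma read_neighbour_component:
  assumes "b' < card C" "b < k"
  shows "read_neighbour x (arcs E) g b b' (enumerate C b') =
    (if b < card C \<and> (enumerate C b', enumerate C b) \<in> arcs E then enumerate C b else 0)"
proof -
  have "x (enumerate C b' div q) (g * k + b') = enumerate C b'"
    using picks_component[of b' b'] assms Ck by (simp add: picks_def)
  then show ?thesis
    using enumerate_component_bounds[of b'] enumerate_component_bounds[of b] assms
    by (simp add: read_neighbour_def colour_sum_component vertex_or_zero_def)
qed

lemma explore_component:
  assumes "b < k"
  shows "explore x (arcs E) g (enumerate C 0 div q) t b =
    (if b < card C \<and> enumerate C b \<in> near t then enumerate C b else 0)"
  using assms
proof (induction t arbitrary: b)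
  case 0
  have pos: "0 < card C" by (rule card_component_pos[OF C])
  have "x (enumerate C 0 div q) (g * k) = enumerate C 0"
    using picks_component[OF pos, of 0] 0 by (simp add: picks_def)
  then show ?case
    using enumerate_component_bounds[OF pos] enumerate_eq_iff[OF finite_component[OF C] _ pos, of b] pos
    by (auto simp: vertex_or_zero_def near_def)
next
  case (Suc t)
  define v where "v = (if b < card C then enumerate C b else 0)"
  define ys where "ys = explore x (arcs E) g (enumerate C 0 div q) t b #
    map (\<lambda>b'. read_neighbour x (arcs E) g b b'
      (explore x (arcs E) g (enumerate C 0 div q) t b')) [0..<k]"
  have read: "read_neighbour x (arcs E) g b b' (explore x (arcs E) g (enumerate C 0 div q) t b') =
      (if b' < card C \<and> enumerate C b' \<in> near t \<and> (enumerate C b', enumerate C b) \<in> arcs E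
       then v else 0)"
    if "b' < k" for b'
    using Suc.IH[OF that] read_neighbour_component[OF _ Suc.prems, of b']
    by (auto simp: v_def read_neighbour_def)
  have "explore x (arcs E) g (enumerate C 0 div q) (Suc t) b = (if v \<in> set ys then v else 0)"
    unfolding explore.simps ys_def[symmetric]
    using Suc.IH[OF Suc.prems] read by (intro first_nonzero_const) (auto simp: ys_def v_def)
  moreover have "v \<in> set ys \<longleftrightarrow> enumerate C b \<in> near (Suc t)" if b: "b < card C"
  proof -
    have "v \<in> set ys \<longleftrightarrow> enumerate C b \<in> near t \<or>
        (\<exists>b'<k. b' < card C \<and> enumerate C b' \<in> near t \<and> (enumerate C b', enumerate C b) \<in> arcs E)"
      using Suc.IH[OF Suc.prems] read b enumerate_component_bounds[OF b]
      by (auto simp: ys_def v_def image_iff)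
    also have "\<dots> \<longleftrightarrow> enumerate C b \<in> near (Suc t)"
      unfolding near_Suc using near_subset[of t] enumerate_component_surj Ck
      by (fastforce simp: Image_def)
    finally show ?thesis .
  qed
  ultimately show ?case by (auto simp: v_def)
qed

lemma certifies_component:
  assumes Cn: "card C < n" and c: "\<And>b. b < k \<Longrightarrow> c b = (if b < card C then enumerate C b else 0)"
  shows "certifies x (arcs E) g c"
proof -
  have found: "found c = {..<card C}"
    using enumerate_component_bounds Ck by (auto simp: found_def c split: if_splits)
  have "card {v. (c b, v) \<in> arcs E} =
      card {b' \<in> found c. colour_sum x (arcs E) g b' (c b) = n + c b'}"
    if b: "b < card C" for b
  proof -
    let ?J = "{b' \<in> found c. (c b, c b') \<in> arcs E}"
    have "{b' \<in> found c. colour_sum x (arcs E) g b' (c b) = n + c b'} = ?J"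
      using b Ck Cn enumerate_component_bounds
      by (auto simp: found c colour_sum_component split: if_splits)
    moreover have "{v. (c b, v) \<in> arcs E} = c ` ?J"
      using component_closed[OF C E enumerate_component[OF b]] enumerate_component_surj b Ck
      by (force simp: found c)
    moreover have "inj_on c ?J"
      using enumerate_eq_iff[OF finite_component[OF C]] Ck by (auto simp: inj_on_def found c)
    ultimately show ?thesis by (simp add: card_image)
  qed
  moreover have "inj_on c (found c)"
    using enumerate_eq_iff[OF finite_component[OF C]] Ck by (auto simp: inj_on_def found c)
  moreover have "picks x (c b, g * k + b)" if "b < card C" for b
    using picks_component[of b b] that Ck by (simp add: c)
  ultimately show ?thesis
    using Cn card_component_pos[OF C] unfolding certifies_def by (simp add: found)
qed

lemma catches_imp_detects:
  assumes "card C < n" "g < M"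
  shows "\<exists>i\<le>n div q. detects x (arcs E) i"
proof -
  have "certifies x (arcs E) g (explore x (arcs E) g (enumerate C 0 div q) (k * k))"
    using explore_component[of _ "k * k"] near_square enumerate_component
    by (intro certifies_component[OF assms(1)]) simp
  moreover have "enumerate C 0 div q \<le> n div q"
    using enumerate_component_bounds[OF card_component_pos[OF C]] by (intro div_le_mono) simp
  ultimately show ?thesis using assms(2) unfolding detects_def by blast
qed

end

lemma prob_detects_ge:
  assumes E: "E \<subseteq> edges_on n" and not_conn: "\<not> connected_graph n E" and q: "16 * k * k \<le> q"
    and large: "16 / 5 * real q ^ k \<le> real M * real (card {C \<in> graph_components n E. card C \<le> k})"
  shows "2 / 3 \<le> measure_pmf.prob samples {x. \<exists>i\<le>n div q. detects x (arcs E) i}"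
proof -
  define Q where "Q = {C \<in> graph_components n E. card C \<le> k}"
  have "2 / 3 \<le> measure_pmf.prob samples {x. \<exists>g<M. \<exists>C\<in>Q. catches x g C}"
  proof (rule prob_exists_catches[OF _ _ _ _ q])
    show "disjoint Q" using disjoint_components[of n E] by (auto simp: Q_def disjoint_def)
    show "C \<subseteq> {1..n}" if "C \<in> Q" for C using that component_subset unfolding Q_def by blast
  qed (use large in \<open>simp_all add: Q_def finite_components\<close>)
  also have "\<dots> \<le> measure_pmf.prob samples {x. \<exists>i\<le>n div q. detects x (arcs E) i}"
  proof (rule measure_pmf.finite_measure_mono)
    show "{x. \<exists>g<M. \<exists>C\<in>Q. catches x g C} \<subseteq> {x. \<exists>i\<le>n div q. detects x (arcs E) i}"
      using catches_imp_detects[OF E] card_component_less[OF _ not_conn] by (fastforce simp: Q_def)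
  qed simp
  finally show ?thesis .
qed

end

section \<open>Expressions\<close>

definition cell :: "nat \<Rightarrow> aexp" where
  "cell c = Load (Const c)"

definition not_exp :: "aexp \<Rightarrow> aexp" where
  "not_exp e = Binop Equal e (Const 0)"

definition all_exp :: "aexp list \<Rightarrow> aexp" where
  "all_exp es = foldr (\<lambda>e c. Binop Times (Binop Less (Const 0) e) c) es (Const 1)"

definition any_exp :: "aexp list \<Rightarrow> aexp" where
  "any_exp es = not_exp (all_exp (map not_exp es))"

definition implies_exp :: "aexp \<Rightarrow> aexp \<Rightarrow> aexp" where
  "implies_exp d e = any_exp [not_exp d, e]"

definition sum_exp :: "aexp list \<Rightarrow> aexp" where
  "sum_exp es = foldr (Binop Plus) es (Const 0)"

definition first_nonzero_exp :: "aexp list \<Rightarrow> aexp" where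
  "first_nonzero_exp es = foldr (\<lambda>e c. Binop Plus e (Binop Times (not_exp e) c)) es (Const 0)"

primrec pow_exp :: "aexp \<Rightarrow> nat \<Rightarrow> aexp" where
  "pow_exp e 0 = Const 1"
| "pow_exp e (Suc j) = Binop Times e (pow_exp e j)"

lemma eval_cell: "c < 2 ^ w \<Longrightarrow> eval w (cell c) m = m c"
  by (simp add: cell_def)

lemma eval_not_exp: "0 < w \<Longrightarrow> eval w (not_exp e) m = of_bool (eval w e m = 0)"
  by (simp add: not_exp_def)

lemma eval_all_exp: "0 < w \<Longrightarrow> eval w (all_exp es) m = of_bool (\<forall>e\<in>set es. eval w e m \<noteq> 0)"
  by (induction es) (auto simp: all_exp_def)

lemma eval_any_exp: "0 < w \<Longrightarrow> eval w (any_exp es) m = of_bool (\<exists>e\<in>set es. eval w e m \<noteq> 0)"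
  by (simp add: any_exp_def eval_not_exp eval_all_exp)

lemma eval_implies_exp:
  "0 < w \<Longrightarrow> eval w (implies_exp d e) m = of_bool (eval w d m \<noteq> 0 \<longrightarrow> eval w e m \<noteq> 0)"
  by (simp add: implies_exp_def eval_any_exp eval_not_exp)

lemma eval_sum_exp:
  "(\<Sum>e\<leftarrow>es. eval w e m) < 2 ^ w \<Longrightarrow> eval w (sum_exp es) m = (\<Sum>e\<leftarrow>es. eval w e m)"
  by (induction es) (auto simp: sum_exp_def)

lemma eval_sum_exp_of_bool:
  assumes "\<And>b. b < j \<Longrightarrow> eval w (e b) m = of_bool (P b)" "j < 2 ^ w"
  shows "eval w (sum_exp (map e [0..<j])) m = card {b. b < j \<and> P b}"
proof -
  have "(\<Sum>e\<leftarrow>map e [0..<j]. eval w e m) = (\<Sum>b<j. eval w (e b) m)"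
    by (simp add: interv_sum_list_conv_sum_set_nat atLeast0LessThan o_def)
  also have "\<dots> = (\<Sum>b<j. of_bool (P b))" using assms(1) by simp
  also have "\<dots> = card ({..<j} \<inter> Collect P)" by (subst sum_of_bool_eq) auto
  also have "{..<j} \<inter> Collect P = {b. b < j \<and> P b}" by auto
  finally have sum: "(\<Sum>e\<leftarrow>map e [0..<j]. eval w e m) = card {b. b < j \<and> P b}" .
  have "card {b. b < j \<and> P b} \<le> card {..<j}" by (intro card_mono) auto
  then show ?thesis using eval_sum_exp[of w m "map e [0..<j]"] assms(2) unfolding sum by simp
qed

lemma eval_first_nonzero_exp:
  assumes "0 < w" "\<And>e. e \<in> set es \<Longrightarrow> eval w e m < 2 ^ w"
  shows "eval w (first_nonzero_exp es) m = first_nonzero (map (\<lambda>e. eval w e m) es)"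
  using assms(2)
proof (induction es)
  case (Cons e es)
  have "first_nonzero (map (\<lambda>e. eval w e m) es) < 2 ^ w"
    using Cons.prems by (intro first_nonzeroI[where P = "\<lambda>y. y < 2 ^ w"]) auto
  then show ?case
    using Cons eval_not_exp[OF assms(1), of e m]
    by (simp add: first_nonzero_exp_def first_nonzero_def)
qed (simp add: first_nonzero_exp_def first_nonzero_def)

lemma eval_pow_exp:
  assumes "0 < w" "0 < eval w e m" "eval w e m ^ j < 2 ^ w"
  shows "eval w (pow_exp e j) m = eval w e m ^ j"
  using assms(3)
proof (induction j)
  case (Suc j)
  have "eval w e m ^ j \<le> eval w e m ^ Suc j" using assms(2) by (intro power_increasing) auto
  then have "eval w (pow_exp e j) m = eval w e m ^ j"
    using Suc by (intro Suc.IH) (rule le_less_trans)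
  then show ?case using Suc.prems by simp
qed (use assms(1) in simp)

section \<open>The linear sketch\<close>

text \<open>Cell 4 holds the block length \<open>q\<close>, cell 5 the number of edges, cell 6 a loop counter and cell 7 the
  rejection flag. From cell 8 on there is a record of \<open>k + 2\<close> cells for each slot: the sampled vertex,
  its degree, and for each colour the sum of \<open>n + v\<close> over its neighbours \<open>v\<close> that are sampled with this
  colour in the same group.\<close>

definition record_exp :: "nat \<Rightarrow> aexp \<Rightarrow> nat \<Rightarrow> aexp" where
  "record_exp k e f = Binop Plus (Const (8 + f)) (Binop Times e (Const (k + 2)))"

definition slot_exp :: "nat \<Rightarrow> nat \<Rightarrow> aexp \<Rightarrow> nat \<Rightarrow> aexp" where
  "slot_exp k M v a = Binop Plus (Binop Times (Binop Div v (cell 4)) (Const (M * k))) (Const a)"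

definition field_exp :: "nat \<Rightarrow> nat \<Rightarrow> aexp \<Rightarrow> nat \<Rightarrow> nat \<Rightarrow> aexp" where
  "field_exp k M v a f = Load (record_exp k (slot_exp k M v a) f)"

locale sketch = block_sampling n q k M for n q k M :: nat +
  fixes w S :: nat
  assumes n_pos: "0 < n" and k_pos: "0 < k"
    and memory_size: "8 + num_slots * (k + 2) \<le> S" and S_less_word: "S < 2 ^ w"
    and values_less_word: "2 * n * n + 4 * n + q + k + 8 < 2 ^ w"
begin

definition addr :: "nat \<Rightarrow> nat \<Rightarrow> nat" where
  "addr j f = 8 + f + j * (k + 2)"

definition weight :: "(nat \<Rightarrow> nat \<Rightarrow> nat) \<Rightarrow> nat \<Rightarrow> nat \<Rightarrow> nat \<Rightarrow> nat" where
  "weight x a f v = (if f = 0 then 1 else if picks x (v, a div k * k + (f - 1)) then n + v else 0)"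

definition content ::
  "(nat \<Rightarrow> nat \<Rightarrow> nat) \<Rightarrow> (nat \<times> nat) set \<Rightarrow> nat \<Rightarrow> nat \<Rightarrow> nat \<Rightarrow> nat" where
  "content x D i a f = (if f = 0 then x i a else \<Sum>v | (x i a, v) \<in> D. weight x a (f - 1) v)"

definition represents :: "(nat \<Rightarrow> nat \<Rightarrow> nat) \<Rightarrow> (nat \<times> nat) set \<Rightarrow> memory \<Rightarrow> bool" where
  "represents x D m \<longleftrightarrow> m 0 = n \<and> m 4 = q \<and> D \<subseteq> {1..n} \<times> {1..n} \<and>
     (\<forall>i\<le>n div q. \<forall>a<M * k. x i a div q = i \<and>
        (\<forall>f<k + 2. m (addr (slot i a) f) = content x D i a f))"

lemma w_pos: "0 < w"
  using values_less_word by (cases "w = 0") auto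

lemma addr_eq_iff:
  assumes "f < k + 2" "f' < k + 2"
  shows "addr j f = addr j' f' \<longleftrightarrow> j = j' \<and> f = f'"
proof -
  have "addr j f = addr j' f' \<longleftrightarrow> j * (k + 2) + f = j' * (k + 2) + f'" unfolding addr_def by linarith
  then show ?thesis by (simp only: mult_add_eq_iff[OF assms])
qed

lemma addr_ge: "8 \<le> addr j f"
  by (simp add: addr_def)

lemma addr_less: "j < num_slots \<Longrightarrow> f < k + 2 \<Longrightarrow> addr j f < S"
  using mult_add_less[of j num_slots f "k + 2"] memory_size unfolding addr_def by linarith

lemma num_slots_less: "num_slots < 2 ^ w"
  using memory_size S_less_word by simp

lemma indices_less: "M * k < 2 ^ w"
  using num_slots_less unfolding num_slots_def by simp

lemma eval_low_cell: "c < 8 \<Longrightarrow> eval w (cell c) m = m c"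
  using values_less_word by (intro eval_cell) simp

lemma eval_record_exp:
  assumes "eval w e m < num_slots" "f < k + 2"
  shows "eval w (record_exp k e f) m = addr (eval w e m) f"
proof -
  have "8 + f + eval w e m * (k + 2) < 2 ^ w"
    using addr_less[OF assms] S_less_word unfolding addr_def by simp
  then show ?thesis using values_less_word by (simp add: record_exp_def addr_def)
qed

lemma eval_slot_exp:
  assumes "eval w v m \<le> n" "m 4 = q" "a < M * k"
  shows "eval w (slot_exp k M v a) m = slot (eval w v m div q) a"
proof -
  have "eval w v m div q \<le> n div q" using assms(1) by (rule div_le_mono)
  then have "slot (eval w v m div q) a < 2 ^ w"
    using slot_less[OF _ assms(3)] num_slots_less less_trans by blast
  moreover have "eval w v m div q < 2 ^ w"
    using assms(1) values_less_word div_le_dividend[of "eval w v m" q] by linarith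
  ultimately show ?thesis
    using assms indices_less eval_low_cell[of 4 m] by (simp add: slot_exp_def slot_def)
qed

lemma eval_field_addr:
  assumes "eval w v m \<le> n" "m 4 = q" "a < M * k" "f < k + 2"
  shows "eval w (record_exp k (slot_exp k M v a) f) m = addr (slot (eval w v m div q) a) f"
proof -
  have "eval w v m div q \<le> n div q" using assms(1) by (rule div_le_mono)
  then show ?thesis
    using eval_record_exp[of "slot_exp k M v a" m f] slot_less[OF _ assms(3)] eval_slot_exp[OF assms(1-3)]
      assms(4) by simp
qed

lemma eval_field:
  assumes "eval w v m \<le> n" "m 4 = q" "a < M * k" "f < k + 2"
  shows "eval w (field_exp k M v a f) m = m (addr (slot (eval w v m div q) a) f)"
  using eval_field_addr[OF assms] by (simp add: field_exp_def)

lemma representsD: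
  assumes "represents x D m"
  shows "m 0 = n" "m 4 = q" "D \<subseteq> {1..n} \<times> {1..n}"
    "i \<le> n div q \<Longrightarrow> a < M * k \<Longrightarrow> x i a div q = i"
    "i \<le> n div q \<Longrightarrow> a < M * k \<Longrightarrow> f < k + 2 \<Longrightarrow> m (addr (slot i a) f) = content x D i a f"
  using assms unfolding represents_def by auto

lemma represents_cong:
  assumes "represents x D m" "m' 0 = m 0" "m' 4 = m 4" "\<And>z. 8 \<le> z \<Longrightarrow> m' z = m z"
  shows "represents x D m'"
  using assms addr_ge unfolding represents_def by simp

lemma eval_field_content:
  assumes m: "represents x D m" and "eval w v m \<le> n" "a < M * k" "f < k + 2"
  shows "eval w (field_exp k M v a f) m = content x D (eval w v m div q) a f"
  using eval_field[OF assms(2) representsD(2)[OF m] assms(3,4)]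
    representsD(5)[OF m div_le_mono[OF assms(2)] assms(3,4)] by simp

lemma finite_successors: "D \<subseteq> {1..n} \<times> {1..n} \<Longrightarrow> finite {v. (u, v) \<in> D}"
  by (rule finite_subset[of _ "{1..n}"]) auto

lemma weight_le: "v \<le> n \<Longrightarrow> weight x a f v \<le> 2 * n"
  using n_pos by (auto simp: weight_def)

lemma content_le:
  assumes "D \<subseteq> {1..n} \<times> {1..n}"
  shows "content x D i a (Suc f) \<le> 2 * n * n"
proof -
  have sub: "{v. (x i a, v) \<in> D} \<subseteq> {1..n}" using assms by auto
  have "content x D i a (Suc f) = (\<Sum>v | (x i a, v) \<in> D. weight x a f v)" by (simp add: content_def)
  also have "\<dots> \<le> of_nat (card {v. (x i a, v) \<in> D}) * (2 * n)"
    using sub by (intro sum_bounded_above weight_le) auto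
  also have "\<dots> \<le> n * (2 * n)" using card_mono[OF _ sub] by (intro mult_le_mono1) simp
  finally show ?thesis by (simp add: mult_ac)
qed

lemma content_vertex: "content x D i a 0 = x i a"
  by (simp add: content_def)

lemma content_degree: "content x D i a (Suc 0) = card {v. (x i a, v) \<in> D}"
  by (simp add: content_def weight_def)

lemma content_colour_sum:
  assumes "D \<subseteq> {1..n} \<times> {1..n}" "b' < k"
  shows "content x D i (g * k + b') (b + 2) = colour_sum x D g b (x i (g * k + b'))"
  using sum.inter_filter[OF finite_successors[OF assms(1)], where g = "\<lambda>v. n + v"
      and P = "\<lambda>v. picks x (v, g * k + b)"] assms(2)
  by (simp add: content_def weight_def colour_sum_def)

lemma content_sym_diff:
  assumes D: "D \<subseteq> {1..n} \<times> {1..n}"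
  shows "content x (sym_diff D {(u, v)}) i a (Suc f) =
    (if x i a \<noteq> u then content x D i a (Suc f)
     else if (u, v) \<in> D then content x D i a (Suc f) - weight x a f v
     else content x D i a (Suc f) + weight x a f v)"
proof -
  let ?N = "{y. (x i a, y) \<in> D}"
  consider "x i a \<noteq> u" | "x i a = u" "(u, v) \<in> D" | "x i a = u" "(u, v) \<notin> D" by blast
  then show ?thesis
  proof cases
    case 1
    then have "{y. (x i a, y) \<in> sym_diff D {(u, v)}} = ?N" by auto
    then show ?thesis using 1 by (simp add: content_def)
  next
    case 2
    then have "{y. (x i a, y) \<in> sym_diff D {(u, v)}} = ?N - {v}" by auto
    then show ?thesis
      using 2 sum.remove[OF finite_successors[OF D], of v u "weight x a f"]
      by (simp add: content_def)
  next
    case 3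
    then have "{y. (x i a, y) \<in> sym_diff D {(u, v)}} = insert v ?N" by auto
    then show ?thesis using 3 finite_successors[OF D] by (simp add: content_def)
  qed
qed

end

section \<open>Updating the sketch\<close>

definition weight_exp :: "nat \<Rightarrow> nat \<Rightarrow> nat \<Rightarrow> nat \<Rightarrow> nat \<Rightarrow> aexp" where
  "weight_exp k M cv a f =
     (if f = 0 then Const 1
      else Binop Times (Binop Equal (field_exp k M (cell cv) (a div k * k + (f - 1)) 0) (cell cv))
             (Binop Plus (cell 0) (cell cv)))"

definition delta_exp :: "nat \<Rightarrow> nat \<Rightarrow> nat \<Rightarrow> nat \<Rightarrow> nat \<Rightarrow> nat \<Rightarrow> aexp" where
  "delta_exp k M cu cv a f =
     Binop Times (Binop Equal (field_exp k M (cell cu) a 0) (cell cu)) (weight_exp k M cv a f)"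

definition change_exp :: "aexp \<Rightarrow> aexp \<Rightarrow> aexp" where
  "change_exp old d = Binop Minus (Binop Plus old (Binop Times (cell 1) d))
     (Binop Times (Binop Minus (Const 1) (cell 1)) d)"

definition arc_assignment :: "nat \<Rightarrow> nat \<Rightarrow> nat \<Rightarrow> nat \<Rightarrow> nat \<times> nat \<Rightarrow> aexp \<times> aexp" where
  "arc_assignment k M cu cv = (\<lambda>(a, f).
     (record_exp k (slot_exp k M (cell cu) a) (Suc f),
      change_exp (field_exp k M (cell cu) a (Suc f)) (delta_exp k M cu cv a f)))"

definition arc_prog :: "nat \<Rightarrow> nat \<Rightarrow> nat \<Rightarrow> nat \<Rightarrow> com" where
  "arc_prog k M cu cv =
     stores (map (arc_assignment k M cu cv) (List.product [0..<M * k] [0..<k + 1]))"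

definition edge_prog :: "nat \<Rightarrow> nat \<Rightarrow> com" where
  "edge_prog k M = Seq (Store (Const 5) (change_exp (cell 5) (Const 1)))
     (Seq (arc_prog k M 2 3) (arc_prog k M 3 2))"

context sketch
begin

lemma ensures_Store_cell:
  assumes "c < 8" "Q (m(c := eval w e m))"
  shows "ensures w S 1 (Store (Const c) e) m Q"
  using assms memory_size values_less_word by (intro ensures_Store) simp_all

lemma eval_change_exp:
  assumes "m 1 = of_bool P" "eval w old m + eval w d m < 2 ^ w"
  shows "eval w (change_exp old d) m =
    (if P then eval w old m + eval w d m else eval w old m - eval w d m)"
proof -
  have "1 < (2::nat) ^ w" "eval w old m < 2 ^ w" "eval w d m < 2 ^ w"
    "eval w old m - eval w d m < 2 ^ w"
    using assms(2) values_less_word by linarith+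
  then show ?thesis
    using assms eval_low_cell[of 1 m] w_pos by (simp add: change_exp_def)
qed

lemma eval_weight_exp:
  assumes "m 0 = n" "m 4 = q" "m cv = v" "cv < 8" "v \<le> n" "a < M * k" "f \<le> k"
    and x: "\<And>b. b < M * k \<Longrightarrow> m (addr (slot (v div q) b) 0) = x (v div q) b"
  shows "eval w (weight_exp k M cv a f) m = weight x a f v"
proof (cases "f = 0")
  case True
  then show ?thesis using w_pos by (simp add: weight_exp_def weight_def)
next
  case False
  let ?b = "a div k * k + (f - 1)"
  have "a div k < M" using assms(6) by (simp add: less_mult_imp_div_less)
  then have b: "?b < M * k" using assms(7) False by (intro mult_add_less) simp_all
  have v: "eval w (cell cv) m = v" "eval w (cell 0) m = n" using eval_low_cell assms by auto
  have "eval w (field_exp k M (cell cv) ?b 0) m = x (v div q) ?b"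
    using eval_field[of "cell cv" m ?b 0] x[OF b] assms(2,5) b v by simp
  moreover have "n + v < 2 ^ w" "1 < (2::nat) ^ w" using values_less_word assms(5) by linarith+
  ultimately show ?thesis using False v by (simp add: weight_exp_def weight_def picks_def)
qed

lemma eval_arc_assignment:
  assumes m: "represents x D m" and u: "m cu = u" "cu < 8" "u \<in> {1..n}"
    and v: "m cv = v" "cv < 8" "v \<in> {1..n}"
    and flag: "m 1 = of_bool ((u, v) \<notin> D)" and af: "a < M * k" "f \<le> k"
    and low: "\<And>z. z < 8 \<Longrightarrow> m' z = m z" and vertices: "\<And>j. m' (addr j 0) = m (addr j 0)"
    and own: "m' (addr (slot (u div q) a) (Suc f)) = m (addr (slot (u div q) a) (Suc f))"
  shows "eval w (fst (arc_assignment k M cu cv (a, f))) m' = addr (slot (u div q) a) (Suc f)"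
    and "eval w (snd (arc_assignment k M cu cv (a, f))) m' =
      content x (sym_diff D {(u, v)}) (u div q) a (Suc f)"
proof -
  have iu: "u div q \<le> n div q" and iv: "v div q \<le> n div q" using u v by (auto intro: div_le_mono)
  have m': "m' 0 = n" "m' 4 = q" "m' cu = u" "m' cv = v" "m' 1 = of_bool ((u, v) \<notin> D)"
    using low u v flag representsD(1,2)[OF m] by auto
  have cu: "eval w (cell cu) m' = u" using eval_low_cell[of cu m'] u(2) m'(3) by simp
  have x: "m' (addr (slot i b) 0) = x i b" if "i \<le> n div q" "b < M * k" for i b
    using vertices representsD(5)[OF m that, of 0] by (simp add: content_vertex)
  show "eval w (fst (arc_assignment k M cu cv (a, f))) m' = addr (slot (u div q) a) (Suc f)"
    using eval_field_addr[of "cell cu" m' a "Suc f"] cu u(3) m'(2) af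
    by (simp add: arc_assignment_def)
  have old: "eval w (field_exp k M (cell cu) a (Suc f)) m' = content x D (u div q) a (Suc f)"
    using eval_field[of "cell cu" m' a "Suc f"] cu u(3) m'(2) af own
      representsD(5)[OF m iu af(1), of "Suc f"]
    by simp
  have "eval w (field_exp k M (cell cu) a 0) m' = x (u div q) a"
    using eval_field[of "cell cu" m' a 0] cu u(3) m'(2) af x[OF iu, of a] by simp
  moreover have "eval w (weight_exp k M cv a f) m' = weight x a f v"
    using m' v af x[OF iv] by (intro eval_weight_exp) auto
  moreover have wle: "weight x a f v \<le> 2 * n" using v(3) by (intro weight_le) simp
  then have "weight x a f v < 2 ^ w" "1 < (2::nat) ^ w" using values_less_word by linarith+
  ultimately have d: "eval w (delta_exp k M cu cv a f) m' =
      (if x (u div q) a = u then weight x a f v else 0)"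
    using cu by (simp add: delta_exp_def)
  have "content x D (u div q) a (Suc f) + weight x a f v < 2 ^ w"
    using content_le[OF representsD(3)[OF m], of x "u div q" a f] wle values_less_word by linarith
  then show "eval w (snd (arc_assignment k M cu cv (a, f))) m' =
      content x (sym_diff D {(u, v)}) (u div q) a (Suc f)"
    using m'(5) eval_change_exp[of m' "(u, v) \<notin> D" "field_exp k M (cell cu) a (Suc f)"
        "delta_exp k M cu cv a f"]
    by (simp add: arc_assignment_def old d content_sym_diff[OF representsD(3)[OF m]])
qed

lemma represents_arc_update:
  assumes m: "represents x D m" and uv: "u \<in> {1..n}" "v \<in> {1..n}" and low: "\<And>z. z < 8 \<Longrightarrow> m' z = m z"
    and changed: "\<And>a f. a < M * k \<Longrightarrow> f \<le> k \<Longrightarrow>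
      m' (addr (slot (u div q) a) (Suc f)) = content x (sym_diff D {(u, v)}) (u div q) a (Suc f)"
    and kept: "\<And>i a f. a < M * k \<Longrightarrow> f < k + 2 \<Longrightarrow> i \<noteq> u div q \<or> f = 0 \<Longrightarrow>
      m' (addr (slot i a) f) = m (addr (slot i a) f)"
  shows "represents x (sym_diff D {(u, v)}) m'"
proof -
  have "m' (addr (slot i a) f) = content x (sym_diff D {(u, v)}) i a f"
    if ia: "i \<le> n div q" "a < M * k" and f: "f < k + 2" for i a f
  proof (cases "i \<noteq> u div q \<or> f = 0")
    case True
    have "m' (addr (slot i a) f) = content x D i a f"
      using kept[OF ia(2) f True] representsD(5)[OF m ia f] by simp
    also have "\<dots> = content x (sym_diff D {(u, v)}) i a f"
      using True representsD(4)[OF m ia] content_sym_diff[OF representsD(3)[OF m], of x u v i a "f - 1"]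
      by (cases f) (auto simp: content_vertex)
    finally show ?thesis .
  next
    case False
    then show ?thesis using changed[OF ia(2), of "f - 1"] f by simp
  qed
  then show ?thesis using m low uv unfolding represents_def by auto
qed

lemma ensures_arc_prog:
  assumes m: "represents x D m" and u: "m cu = u" "cu < 8" "u \<in> {1..n}"
    and v: "m cv = v" "cv < 8" "v \<in> {1..n}" and flag: "m 1 = of_bool ((u, v) \<notin> D)"
  shows "ensures w S (2 * (M * k * (k + 1))) (arc_prog k M cu cv) m
    (\<lambda>m'. represents x (sym_diff D {(u, v)}) m' \<and> (\<forall>z<8. m' z = m z))"
proof -
  define ps where "ps = List.product [0..<M * k] [0..<k + 1]"
  define ad where "ad = (\<lambda>(a, f). addr (slot (u div q) a) (Suc f))"
  define new where "new = (\<lambda>(a, f). content x (sym_diff D {(u, v)}) (u div q) a (Suc f))"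
  have ps: "distinct ps" "length ps = M * k * (k + 1)" "set ps = {..<M * k} \<times> {..k}"
    by (auto simp: ps_def distinct_product)
  have iu: "u div q \<le> n div q" using u(3) by (auto intro: div_le_mono)
  have low: "z \<notin> ad ` set ps" if "z < 8" for z
    using that addr_ge by (auto simp: ad_def not_less[symmetric])
  have vertices: "addr j 0 \<notin> ad ` set ps" for j by (auto simp: ad_def ps(3) addr_eq_iff)
  have other: "addr (slot i a) f \<notin> ad ` set ps"
    if "a < M * k" "f < k + 2" "i \<noteq> u div q \<or> f = 0" for i a f
    using that by (auto simp: ad_def ps(3) addr_eq_iff slot_eq_iff)
  have "ensures w S (2 * length ps) (arc_prog k M cu cv) m
      (\<lambda>m'. (\<forall>p\<in>set ps. m' (ad p) = new p) \<and> (\<forall>z. z \<notin> ad ` set ps \<longrightarrow> m' z = m z))"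
    unfolding arc_prog_def ps_def[symmetric]
  proof (rule ensures_stores[OF ps(1)])
    show "inj_on ad (set ps)"
      by (rule inj_onI) (auto simp: ad_def ps(3) addr_eq_iff slot_eq_iff)
    show "ad p < S" if "p \<in> set ps" for p
      using that slot_less[OF iu] by (auto simp: ad_def ps(3) intro!: addr_less)
    show "eval w (fst (arc_assignment k M cu cv p)) m' = ad p \<and>
        eval w (snd (arc_assignment k M cu cv p)) m' = new p"
      if "p \<in> set ps" "m' (ad p) = m (ad p)" "\<And>z. z \<notin> ad ` set ps \<Longrightarrow> m' z = m z" for p m'
      using eval_arc_assignment[OF m u v flag, of "fst p" "snd p" m'] that low vertices
      by (auto simp: ad_def new_def ps(3))
  qed
  then show ?thesis
    unfolding ps(2)
  proof (rule realizes_mono[OF _ order.refl])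
    fix m' assume "(\<forall>p\<in>set ps. m' (ad p) = new p) \<and> (\<forall>z. z \<notin> ad ` set ps \<longrightarrow> m' z = m z)"
    then show "represents x (sym_diff D {(u, v)}) m' \<and> (\<forall>z<8. m' z = m z)"
      using low other
      by (intro conjI represents_arc_update[OF m u(3) v(3)]) (auto simp: ps(3) ad_def new_def)
  qed
qed

definition tracks :: "(nat \<Rightarrow> nat \<Rightarrow> nat) \<Rightarrow> nat set set \<Rightarrow> memory \<Rightarrow> bool" where
  "tracks x E m \<longleftrightarrow> represents x (arcs E) m \<and> m 5 = card E"

lemma ensures_count_update:
  assumes E: "E \<subseteq> edges_on n" and m: "m 5 = card E" "m 1 = of_bool (e \<notin> E)"
  shows "ensures w S 1 (Store (Const 5) (change_exp (cell 5) (Const 1))) m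
    (\<lambda>m'. m' = m(5 := card (sym_diff E {e})))"
proof (rule ensures_Store_cell)
  have "card E + 1 < 2 ^ w" using card_edges_le[OF E] values_less_word by linarith
  then have "eval w (change_exp (cell 5) (Const 1)) m = (if e \<notin> E then card E + 1 else card E - 1)"
    using eval_change_exp[of m "e \<notin> E" "cell 5" "Const 1"] m w_pos by (simp add: eval_low_cell)
  also have "\<dots> = card (sym_diff E {e})"
    using finite_subset[OF E finite_edges_on] by (auto simp: Un_commute)
  finally show "m(5 := eval w (change_exp (cell 5) (Const 1)) m) = m(5 := card (sym_diff E {e}))"
    by simp
qed simp

lemma ensures_edge_prog:
  assumes m: "tracks x E m" and E: "E \<subseteq> edges_on n" and e: "valid_stream_from n E [e]"
  shows "ensures w S (4 * (M * k * (k + 1)) + 3) (edge_prog k M) (feed e m)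
    (tracks x (apply_update e E))"
proof -
  obtain u v where uv: "{u, v} \<in> edges_on n" and E': "apply_update e E = sym_diff E {{u, v}}"
    and feed: "feed e m = m(1 := of_bool ({u, v} \<notin> E), 2 := u, 3 := v)"
    using valid_update_sym_diff[OF e E] by metis
  note uv = edges_onD[OF uv]
  define m0 where "m0 = feed e m"
  have rep: "represents x (arcs E) m" and m5: "m 5 = card E" using m by (auto simp: tracks_def)
  have count: "ensures w S 1 (Store (Const 5) (change_exp (cell 5) (Const 1))) m0
      (\<lambda>m'. m' = m0(5 := card (apply_update e E)))"
    unfolding E' using E m5 by (intro ensures_count_update) (simp_all add: m0_def feed)
  define m1 where "m1 = m0(5 := card (apply_update e E))"
  have "represents x (arcs E) m1"
    using rep by (rule represents_cong) (auto simp: m1_def m0_def feed)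
  then have first: "ensures w S (2 * (M * k * (k + 1))) (arc_prog k M 2 3) m1
      (\<lambda>m'. represents x (sym_diff (arcs E) {(u, v)}) m' \<and> (\<forall>z<8. m' z = m1 z))"
    using uv by (intro ensures_arc_prog) (auto simp: m1_def m0_def feed arcs_def)
  have second: "ensures w S (2 * (M * k * (k + 1))) (arc_prog k M 3 2) m'
      (tracks x (apply_update e E))"
    if "represents x (sym_diff (arcs E) {(u, v)}) m' \<and> (\<forall>z<8. m' z = m1 z)" for m'
  proof -
    have "ensures w S (2 * (M * k * (k + 1))) (arc_prog k M 3 2) m'
        (\<lambda>m''. represents x (sym_diff (sym_diff (arcs E) {(u, v)}) {(v, u)}) m'' \<and>
          (\<forall>z<8. m'' z = m' z))"
      using that uv
      by (intro ensures_arc_prog) (auto simp: m1_def m0_def feed arcs_def insert_commute)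
    then show ?thesis
      using that by (elim realizes_mono) (auto simp: tracks_def E' arcs_sym_diff[OF uv(3)] m1_def)
  qed
  have "ensures w S (1 + (2 * (M * k * (k + 1)) + 2 * (M * k * (k + 1)) + 1) + 1) (edge_prog k M) m0
      (tracks x (apply_update e E))"
    unfolding edge_prog_def using ensures_Seq[OF first second]
    by (intro ensures_Seq[OF count]) (simp add: m1_def)
  then show ?thesis unfolding m0_def by (rule realizes_mono) simp_all
qed

end

section \<open>Reading the verdict off the sketch\<close>

definition vertex_or_zero_exp :: "aexp \<Rightarrow> aexp" where
  "vertex_or_zero_exp e = Binop Times e (Binop Less e (Binop Plus (cell 0) (Const 1)))"

definition read_neighbour_exp :: "nat \<Rightarrow> nat \<Rightarrow> nat \<Rightarrow> nat \<Rightarrow> nat \<Rightarrow> aexp \<Rightarrow> aexp" where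
  "read_neighbour_exp k M g b b' v = Binop Times (Binop Less (Const 0) v)
     (vertex_or_zero_exp (Binop Minus (field_exp k M v (g * k + b') (b + 2)) (cell 0)))"

primrec explore_exp :: "nat \<Rightarrow> nat \<Rightarrow> nat \<Rightarrow> nat \<Rightarrow> nat \<Rightarrow> aexp" where
  "explore_exp k M g 0 = (\<lambda>b. if b = 0
     then vertex_or_zero_exp
       (Load (record_exp k (Binop Plus (Binop Times (cell 6) (Const (M * k))) (Const (g * k))) 0))
     else Const 0)"
| "explore_exp k M g (Suc t) = (\<lambda>b. first_nonzero_exp (explore_exp k M g t b #
     map (\<lambda>b'. read_neighbour_exp k M g b b' (explore_exp k M g t b')) [0..<k]))"

definition adjacent_exp :: "nat \<Rightarrow> nat \<Rightarrow> nat \<Rightarrow> (nat \<Rightarrow> aexp) \<Rightarrow> nat \<Rightarrow> nat \<Rightarrow> aexp" where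
  "adjacent_exp k M g c b b' = all_exp [c b',
     Binop Equal (field_exp k M (c b) (g * k + b) (b' + 2)) (Binop Plus (cell 0) (c b'))]"

definition closed_exp :: "nat \<Rightarrow> nat \<Rightarrow> nat \<Rightarrow> (nat \<Rightarrow> aexp) \<Rightarrow> nat \<Rightarrow> aexp" where
  "closed_exp k M g c b = implies_exp (c b) (all_exp
     [Binop Equal (field_exp k M (c b) (g * k + b) 0) (c b),
      Binop Equal (field_exp k M (c b) (g * k + b) 1)
        (sum_exp (map (adjacent_exp k M g c b) [0..<k]))])"

definition distinct_exp :: "(nat \<Rightarrow> aexp) \<Rightarrow> nat \<times> nat \<Rightarrow> aexp" where
  "distinct_exp c = (\<lambda>(b, b'). implies_exp (c b) (not_exp (Binop Equal (c b) (c b'))))"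

definition certify_exp :: "nat \<Rightarrow> nat \<Rightarrow> nat \<Rightarrow> (nat \<Rightarrow> aexp) \<Rightarrow> aexp" where
  "certify_exp k M g c = all_exp
     ([c 0, Binop Less (sum_exp (map (\<lambda>b. any_exp [c b]) [0..<k])) (cell 0)] @
      map (closed_exp k M g c) [0..<k] @
      map (distinct_exp c) (filter (\<lambda>(b, b'). b \<noteq> b') (List.product [0..<k] [0..<k])))"

definition detect_exp :: "nat \<Rightarrow> nat \<Rightarrow> aexp" where
  "detect_exp k M = any_exp (map (\<lambda>g. certify_exp k M g (explore_exp k M g (k * k))) [0..<M])"

definition scan_guard :: aexp where
  "scan_guard = Binop Less (Binop Times (cell 6) (cell 4)) (Binop Plus (cell 0) (Const 1))"

definition scan_body :: "nat \<Rightarrow> nat \<Rightarrow> com" where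
  "scan_body k M = Seq (Store (Const 7) (any_exp [cell 7, detect_exp k M]))
     (Store (Const 6) (Binop Plus (cell 6) (Const 1)))"

definition verdict_prog :: "nat \<Rightarrow> nat \<Rightarrow> com" where
  "verdict_prog k M = Seq (Store (Const 6) (Const 0))
     (Seq (Store (Const 7) (Binop Less (Binop Plus (cell 5) (Const 1)) (cell 0)))
        (Seq (While scan_guard (scan_body k M)) (Store (Const 0) (not_exp (cell 7)))))"

context sketch
begin

lemma small_less_word:
  "n + n < 2 ^ w" "n + 1 < 2 ^ w" "n + q < 2 ^ w" "k + 2 < 2 ^ w" "1 < (2::nat) ^ w"
  using values_less_word by linarith+

lemma eval_n: "represents x D m \<Longrightarrow> eval w (cell 0) m = n"
  using representsD(1) eval_low_cell by simp

lemma eval_vertex_or_zero_exp: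
  assumes "represents x D m" "eval w e m < 2 ^ w"
  shows "eval w (vertex_or_zero_exp e) m = vertex_or_zero (eval w e m)"
  using assms small_less_word eval_n[OF assms(1)]
  by (auto simp: vertex_or_zero_exp_def vertex_or_zero_def)

lemma eval_start_exp:
  assumes m: "represents x D m" and i: "m 6 \<le> n div q" and g: "g < M"
  shows "eval w (Load (record_exp k (Binop Plus (Binop Times (cell 6) (Const (M * k))) (Const (g * k))) 0)) m
    = x (m 6) (g * k)"
proof -
  let ?e = "Binop Plus (Binop Times (cell 6) (Const (M * k))) (Const (g * k))"
  have a: "g * k < M * k" using g k_pos by simp
  have s: "slot (m 6) (g * k) < num_slots" using slot_less[OF i a] .
  then have "eval w ?e m = slot (m 6) (g * k)"
    using num_slots_less indices_less a by (simp add: slot_def eval_low_cell)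
  then have "eval w (record_exp k ?e 0) m = addr (slot (m 6) (g * k)) 0"
    using eval_record_exp[of ?e m 0] s by simp
  then show ?thesis using representsD(5)[OF m i a, of 0] by (simp add: content_vertex)
qed

lemma eval_read_neighbour_exp:
  assumes m: "represents x D m" and g: "g < M" and b: "b < k" "b' < k" and v: "eval w v m \<le> n"
  shows "eval w (read_neighbour_exp k M g b b' v) m = read_neighbour x D g b b' (eval w v m)"
proof -
  let ?e = "Binop Minus (field_exp k M v (g * k + b') (b + 2)) (cell 0)"
  let ?c = "content x D (eval w v m div q) (g * k + b') (b + 2)"
  have a: "g * k + b' < M * k" using g b(2) by (rule mult_add_less)
  have "?c \<le> 2 * n * n"
    using content_le[OF representsD(3)[OF m], of x _ _ "b + 1"] by simp
  then have "?c - n < 2 ^ w" using values_less_word by linarith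
  moreover have "eval w (field_exp k M v (g * k + b') (b + 2)) m = ?c"
    using eval_field_content[OF m v a, of "b + 2"] b(1) by simp
  ultimately have e: "eval w ?e m = ?c - n" "eval w ?e m < 2 ^ w"
    using eval_n[OF m] by auto
  have "vertex_or_zero z \<le> n" for z by (simp add: vertex_or_zero_def)
  then have "vertex_or_zero (?c - n) < 2 ^ w" using small_less_word(2) by (meson le_less_trans add_lessD1)
  then show ?thesis
    using eval_vertex_or_zero_exp[OF m e(2)] e(1) small_less_word(5)
      content_colour_sum[OF representsD(3)[OF m] b(2), of x _ g b]
    by (simp add: read_neighbour_exp_def read_neighbour_def)
qed

lemma eval_explore_exp:
  assumes m: "represents x D m" and i: "m 6 \<le> n div q" and g: "g < M" and b: "b < k"
  shows "eval w (explore_exp k M g t b) m = explore x D g (m 6) t b"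
  using b
proof (induction t arbitrary: b)
  case 0
  have "x (m 6) (g * k) div q = m 6" using representsD(4)[OF m i, of "g * k"] g k_pos by simp
  then have "x (m 6) (g * k) = m 6 * q + x (m 6) (g * k) mod q" by (metis div_mult_mod_eq)
  also have "\<dots> < n + q"
    using i q_pos by (intro add_le_less_mono) (simp_all add: less_eq_div_iff_mult_less_eq)
  finally have "x (m 6) (g * k) < 2 ^ w" using small_less_word(3) by simp
  then show ?case
    using eval_vertex_or_zero_exp[OF m] eval_start_exp[OF m i g] by simp
next
  case (Suc t)
  let ?es = "explore_exp k M g t b #
    map (\<lambda>b'. read_neighbour_exp k M g b b' (explore_exp k M g t b')) [0..<k]"
  have vals: "map (\<lambda>e. eval w e m) ?es = explore x D g (m 6) t b #
      map (\<lambda>b'. read_neighbour x D g b b' (explore x D g (m 6) t b')) [0..<k]"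
    using Suc eval_read_neighbour_exp[OF m g Suc.prems] explore_le by simp
  have le: "y \<le> n" if "y \<in> set (map (\<lambda>e. eval w e m) ?es)" for y
    using that explore_le unfolding vals by (auto simp: read_neighbour_def vertex_or_zero_def)
  have "eval w e m < 2 ^ w" if "e \<in> set ?es" for e
    using le[of "eval w e m"] that small_less_word(2) by force
  then have "eval w (first_nonzero_exp ?es) m = first_nonzero (map (\<lambda>e. eval w e m) ?es)"
    by (rule eval_first_nonzero_exp[OF w_pos])
  then show ?case unfolding vals by simp
qed

context
  fixes x D m g ce c
  assumes m: "represents x D m" and g: "g < M"
    and ce: "\<And>b. b < k \<Longrightarrow> eval w (ce b) m = c b" and c: "\<And>b. c b \<le> n"
begin

lemma eval_certified_field:
  assumes "b < k" "f < k + 2"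
  shows "eval w (field_exp k M (ce b) (g * k + b) f) m = content x D (c b div q) (g * k + b) f"
  using eval_field_content[OF m, of "ce b" "g * k + b" f] mult_add_less[OF g assms(1)] assms ce c
  by simp

lemma eval_adjacent_exp:
  assumes "b < k" "b' < k" "picks x (c b, g * k + b)"
  shows "eval w (adjacent_exp k M g ce b b') m =
    of_bool (b' \<in> found c \<and> colour_sum x D g b' (c b) = n + c b')"
proof -
  have "n + c b' < 2 ^ w" using c[of b'] small_less_word(1) by linarith
  moreover have "content x D (c b div q) (g * k + b) (b' + 2) = colour_sum x D g b' (c b)"
    using content_colour_sum[OF representsD(3)[OF m] assms(1)] assms(3) by (simp add: picks_def)
  ultimately show ?thesis
    using eval_certified_field[OF assms(1), of "b' + 2"] assms(2) eval_n[OF m] ce[OF assms(2)] w_pos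
    by (simp add: adjacent_exp_def eval_all_exp found_def)
qed

lemma eval_closed_exp:
  assumes b: "b < k"
  shows "eval w (closed_exp k M g ce b) m = of_bool (b \<in> found c \<longrightarrow> picks x (c b, g * k + b) \<and>
    card {v. (c b, v) \<in> D} = card {b' \<in> found c. colour_sum x D g b' (c b) = n + c b'})"
proof -
  have vertex: "eval w (field_exp k M (ce b) (g * k + b) 0) m = c b \<longleftrightarrow> picks x (c b, g * k + b)"
    using eval_certified_field[OF b, of 0] by (simp add: content_vertex picks_def)
  have "eval w (field_exp k M (ce b) (g * k + b) 1) m = card {v. (c b, v) \<in> D}"
    if "picks x (c b, g * k + b)"
    using eval_certified_field[OF b, of 1] that by (simp add: content_degree picks_def)
  moreover have "eval w (sum_exp (map (adjacent_exp k M g ce b) [0..<k])) m =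
      card {b' \<in> found c. colour_sum x D g b' (c b) = n + c b'}" if "picks x (c b, g * k + b)"
    using eval_sum_exp_of_bool[OF eval_adjacent_exp[OF b _ that]] small_less_word(4)
    by (simp add: found_def conj_assoc)
  ultimately show ?thesis
    using vertex b w_pos by (auto simp: closed_exp_def eval_implies_exp eval_all_exp ce found_def)
qed

lemma eval_certify_exp: "eval w (certify_exp k M g ce) m = of_bool (certifies x D g c)"
proof -
  have "eval w (any_exp [ce b]) m = of_bool (c b \<noteq> 0)" if "b < k" for b
    using ce[OF that] w_pos by (simp add: eval_any_exp)
  then have "eval w (sum_exp (map (\<lambda>b. any_exp [ce b]) [0..<k])) m = card (found c)"
    using eval_sum_exp_of_bool[of k w "\<lambda>b. any_exp [ce b]" m "\<lambda>b. c b \<noteq> 0"] small_less_word(4)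
    by (simp add: found_def)
  then have size: "eval w (Binop Less (sum_exp (map (\<lambda>b. any_exp [ce b]) [0..<k])) (cell 0)) m =
      of_bool (card (found c) < n)"
    using eval_n[OF m] w_pos by simp
  have "eval w (distinct_exp ce (b, b')) m = of_bool (b \<in> found c \<longrightarrow> c b \<noteq> c b')"
    if "b < k" "b' < k" for b b'
    using w_pos that by (simp add: distinct_exp_def eval_implies_exp eval_not_exp ce found_def)
  then have "(\<forall>b<k. \<forall>b'<k. b \<noteq> b' \<longrightarrow> eval w (distinct_exp ce (b, b')) m \<noteq> 0) \<longleftrightarrow>
      (\<forall>b<k. \<forall>b'<k. b \<noteq> b' \<longrightarrow> b \<in> found c \<longrightarrow> c b \<noteq> c b')"
    by simp
  also have "\<dots> \<longleftrightarrow> inj_on c (found c)"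
    unfolding inj_on_def found_def by (simp, metis)
  finally have distinct: "(\<forall>b<k. \<forall>b'<k. b \<noteq> b' \<longrightarrow> eval w (distinct_exp ce (b, b')) m \<noteq> 0) \<longleftrightarrow>
      inj_on c (found c)" .
  have "eval w (certify_exp k M g ce) m = of_bool (c 0 \<noteq> 0 \<and> card (found c) < n \<and>
      (\<forall>b<k. eval w (closed_exp k M g ce b) m \<noteq> 0) \<and>
      (\<forall>b<k. \<forall>b'<k. b \<noteq> b' \<longrightarrow> eval w (distinct_exp ce (b, b')) m \<noteq> 0))"
    unfolding certify_exp_def eval_all_exp[OF w_pos] using size ce[OF k_pos]
    by (intro arg_cong[where f = of_bool]) (auto simp del: eval.simps)
  also have "\<dots> = of_bool (certifies x D g c)"
    unfolding distinct certifies_def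
    using k_pos by (intro arg_cong[where f = of_bool]) (auto simp: eval_closed_exp found_def)
  finally show ?thesis .
qed

end

lemma eval_detect_exp:
  assumes m: "represents x D m" and i: "m 6 \<le> n div q"
  shows "eval w (detect_exp k M) m = of_bool (detects x D (m 6))"
proof -
  have "eval w (certify_exp k M g (explore_exp k M g (k * k))) m =
      of_bool (certifies x D g (explore x D g (m 6) (k * k)))" if "g < M" for g
    using eval_explore_exp[OF m i that] explore_le by (intro eval_certify_exp[OF m that])
  then show ?thesis
    using w_pos by (auto simp: detect_exp_def detects_def eval_any_exp)
qed

lemma block_less_iff: "i * q < n + 1 \<longleftrightarrow> i \<le> n div q"
  using q_pos by (simp add: less_eq_div_iff_mult_less_eq less_Suc_eq_le)

lemma block_mult_less_word:
  assumes "i \<le> n div q + 1"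
  shows "i * q < 2 ^ w" "i < 2 ^ w"
proof -
  have "i * q \<le> (n div q + 1) * q" using assms by (rule mult_le_mono1)
  also have "\<dots> \<le> n + q" by simp
  finally show "i * q < 2 ^ w" using small_less_word(3) by simp
  then show "i < 2 ^ w" using q_pos by (cases q) auto
qed

lemma eval_scan_guard:
  assumes "represents x D m" "m 6 \<le> n div q + 1"
  shows "eval w scan_guard m = of_bool (m 6 \<le> n div q)"
  using block_less_iff[of "m 6"] block_mult_less_word[OF assms(2)] eval_n[OF assms(1)]
    representsD(2)[OF assms(1)] small_less_word(2) w_pos by (simp add: scan_guard_def eval_low_cell)

lemma ensures_scan_body:
  assumes m: "represents x D m" "m 6 \<le> n div q" "m 7 = of_bool P"
  shows "ensures w S 3 (scan_body k M) m
    (\<lambda>m'. represents x D m' \<and> m' 6 = m 6 + 1 \<and> m' 7 = of_bool (P \<or> detects x D (m 6)))"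
proof -
  define m1 where "m1 = m(7 := of_bool (P \<or> detects x D (m 6)))"
  have "eval w (any_exp [cell 7, detect_exp k M]) m = of_bool (P \<or> detects x D (m 6))"
    using eval_detect_exp[OF m(1,2)] m(3) w_pos by (simp add: eval_any_exp eval_low_cell)
  then have flag: "ensures w S 1 (Store (Const 7) (any_exp [cell 7, detect_exp k M])) m (\<lambda>m'. m' = m1)"
    by (intro ensures_Store_cell) (simp_all add: m1_def)
  have "m 6 + 1 < 2 ^ w" using block_mult_less_word(2)[of "m 6 + 1"] m(2) by simp
  then have "eval w (Binop Plus (cell 6) (Const 1)) m1 = m 6 + 1"
    using w_pos by (simp add: eval_low_cell m1_def)
  moreover have "represents x D (m1(6 := m 6 + 1))"
    using m(1) by (rule represents_cong) (simp_all add: m1_def)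
  ultimately have "ensures w S 1 (Store (Const 6) (Binop Plus (cell 6) (Const 1))) m1
      (\<lambda>m'. represents x D m' \<and> m' 6 = m 6 + 1 \<and> m' 7 = of_bool (P \<or> detects x D (m 6)))"
    by (intro ensures_Store_cell) (simp_all add: m1_def)
  then have "ensures w S (1 + 1 + 1) (scan_body k M) m
    (\<lambda>m'. represents x D m' \<and> m' 6 = m 6 + 1 \<and> m' 7 = of_bool (P \<or> detects x D (m 6)))"
    unfolding scan_body_def by (intro ensures_Seq[OF flag]) simp
  then show ?thesis by (simp add: numeral_3_eq_3)
qed

lemma ensures_scan_loop:
  assumes "represents x D m" "m 6 = 0" "m 7 = of_bool P"
  shows "ensures w S ((n div q + 1) * 5 + 1) (While scan_guard (scan_body k M)) m
    (\<lambda>m'. m' 7 = of_bool (P \<or> (\<exists>i\<le>n div q. detects x D i)))"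
proof -
  define I where
    "I i m' \<longleftrightarrow> represents x D m' \<and> m' 6 = i \<and> m' 7 = of_bool (P \<or> (\<exists>i'<i. detects x D i'))" for i m'
  have "ensures w S ((n div q + 1) * (3 + 2) + 1) (While scan_guard (scan_body k M)) m
      (I (n div q + 1))"
  proof (rule ensures_While)
    show "I 0 m" using assms by (simp add: I_def)
    show "eval w scan_guard m' \<noteq> 0" if "i < n div q + 1" "I i m'" for i m'
      using eval_scan_guard[of x D m'] that by (simp add: I_def)
    show "eval w scan_guard m' = 0" if "I (n div q + 1) m'" for m'
      using eval_scan_guard[of x D m'] that by (simp add: I_def)
    show "ensures w S 3 (scan_body k M) m' (I (Suc i))" if "i < n div q + 1" "I i m'" for i m'
    proof -
      have "represents x D m'" "m' 6 \<le> n div q" "m' 7 = of_bool (P \<or> (\<exists>i'<i. detects x D i'))"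
        using that by (auto simp: I_def)
      from ensures_scan_body[OF this] show ?thesis
        by (rule realizes_mono) (use that in \<open>auto simp: I_def less_Suc_eq\<close>)
    qed
  qed
  then show ?thesis by (rule realizes_mono) (auto simp: I_def less_Suc_eq_le)
qed

lemma ensures_verdict_prog:
  assumes m: "represents x D m" and m5: "m 5 \<le> n * n"
  shows "ensures w S (5 * (n div q) + 20) (verdict_prog k M) m
    (\<lambda>m'. m' 0 \<noteq> 0 \<longleftrightarrow> \<not> (m 5 + 1 < n \<or> (\<exists>i\<le>n div q. detects x D i)))"
proof -
  define m1 where "m1 = m(6 := 0)"
  define m2 where "m2 = m1(7 := of_bool (m 5 + 1 < n))"
  have reset: "ensures w S 1 (Store (Const 6) (Const 0)) m (\<lambda>m'. m' = m1)"
    by (intro ensures_Store_cell) (simp_all add: m1_def)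
  have "m 5 + 1 < 2 ^ w" using m5 values_less_word by linarith
  then have "eval w (Binop Less (Binop Plus (cell 5) (Const 1)) (cell 0)) m1 = of_bool (m 5 + 1 < n)"
    using representsD(1)[OF m] w_pos by (simp add: eval_low_cell m1_def)
  then have few: "ensures w S 1
      (Store (Const 7) (Binop Less (Binop Plus (cell 5) (Const 1)) (cell 0))) m1
      (\<lambda>m'. m' = m2)"
    by (intro ensures_Store_cell) (simp_all add: m2_def)
  have "represents x D m2" using m by (rule represents_cong) (simp_all add: m2_def m1_def)
  then have scan: "ensures w S ((n div q + 1) * 5 + 1) (While scan_guard (scan_body k M)) m2
      (\<lambda>m'. m' 7 = of_bool (m 5 + 1 < n \<or> (\<exists>i\<le>n div q. detects x D i)))"
    by (rule ensures_scan_loop) (simp_all add: m2_def m1_def)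
  have answer: "ensures w S 1 (Store (Const 0) (not_exp (cell 7))) m'
      (\<lambda>m''. m'' 0 \<noteq> 0 \<longleftrightarrow> \<not> (m 5 + 1 < n \<or> (\<exists>i\<le>n div q. detects x D i)))"
    if "m' 7 = of_bool (m 5 + 1 < n \<or> (\<exists>i\<le>n div q. detects x D i))" for m'
    using that w_pos by (intro ensures_Store_cell) (simp_all add: eval_not_exp eval_low_cell)
  have "ensures w S (1 + ((n div q + 1) * 5 + 1 + 1 + 1) + 1)
      (Seq (Store (Const 7) (Binop Less (Binop Plus (cell 5) (Const 1)) (cell 0)))
        (Seq (While scan_guard (scan_body k M)) (Store (Const 0) (not_exp (cell 7))))) m1
      (\<lambda>m'. m' 0 \<noteq> 0 \<longleftrightarrow> \<not> (m 5 + 1 < n \<or> (\<exists>i\<le>n div q. detects x D i)))"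
    using ensures_Seq[OF scan answer] by (intro ensures_Seq[OF few]) simp
  then have "ensures w S (1 + (1 + ((n div q + 1) * 5 + 1 + 1 + 1) + 1) + 1) (verdict_prog k M) m
      (\<lambda>m'. m' 0 \<noteq> 0 \<longleftrightarrow> \<not> (m 5 + 1 < n \<or> (\<exists>i\<le>n div q. detects x D i)))"
    unfolding verdict_prog_def by (intro ensures_Seq[OF reset]) simp
  then show ?thesis by (rule realizes_mono) simp_all
qed

end

section \<open>Setting up the sketch\<close>

definition root_guard :: "nat \<Rightarrow> nat \<Rightarrow> aexp" where
  "root_guard k B = Binop Less (pow_exp (Binop Plus (cell 4) (Const 1)) k)
     (Binop Plus (Binop Times (Const B) (cell 0)) (Const 1))"

definition root_loop :: "nat \<Rightarrow> nat \<Rightarrow> com" where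
  "root_loop k B = While (root_guard k B) (Store (Const 4) (Binop Plus (cell 4) (Const 1)))"

definition offset_exp :: "nat \<Rightarrow> nat \<Rightarrow> aexp" where
  "offset_exp k M = Binop Times (Binop Div (cell 6) (Const (M * k))) (cell 4)"

definition draw_guard :: "nat \<Rightarrow> nat \<Rightarrow> aexp" where
  "draw_guard k M = Binop Less (offset_exp k M) (Binop Plus (cell 0) (Const 1))"

definition shift_prog :: "nat \<Rightarrow> nat \<Rightarrow> com" where
  "shift_prog k M = Seq (Store (record_exp k (cell 6) 0)
       (Binop Plus (Load (record_exp k (cell 6) 0)) (offset_exp k M)))
     (Store (Const 6) (Binop Plus (cell 6) (Const 1)))"

definition draw_body :: "nat \<Rightarrow> nat \<Rightarrow> com" where
  "draw_body k M =
     Seq (Rand (record_exp k (cell 6) 0) (Binop Minus (cell 4) (Const 1))) (shift_prog k M)"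

definition setup_prog :: "nat \<Rightarrow> nat \<Rightarrow> nat \<Rightarrow> com" where
  "setup_prog k M B = Seq (root_loop k B) (While (draw_guard k M) (draw_body k M))"

definition tester_alg :: "nat \<Rightarrow> nat \<Rightarrow> nat \<Rightarrow> nat \<Rightarrow> stream_alg" where
  "tester_alg f k M B = \<lparr>word_factor = f, init_prog = setup_prog k M B,
     update_prog = edge_prog k M, post_prog = verdict_prog k M\<rparr>"

locale tester = sketch n q k M w S for n q k M w S :: nat +
  fixes B f :: nat
  assumes M_pos: "0 < M" and root_le: "q ^ k \<le> B * n" and root_less: "B * n < (q + 1) ^ k"
    and word_root: "(q + 1) ^ k + B + 1 < 2 ^ w" and word_length: "w = f * floorlog 2 n"
begin

lemma eval_root_guard:
  assumes "m 0 = n" "m 4 \<le> q"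
  shows "eval w (root_guard k B) m = of_bool (m 4 < q)"
proof -
  have mono: "(m 4 + 1) ^ k \<le> (q + 1) ^ k" using assms(2) by (intro power_mono) auto
  have "m 4 + 1 \<le> (m 4 + 1) ^ k" using k_pos power_increasing[of 1 k "m 4 + 1"] by simp
  then have W: "m 4 + 1 < 2 ^ w" "B < 2 ^ w" "B * n + 1 < 2 ^ w" "(m 4 + 1) ^ k < 2 ^ w"
    using word_root root_less mono by linarith+
  have "eval w (Binop Plus (cell 4) (Const 1)) m = m 4 + 1"
    using W(1) w_pos by (simp add: eval_low_cell)
  then have "eval w (pow_exp (Binop Plus (cell 4) (Const 1)) k) m = (m 4 + 1) ^ k"
    using eval_pow_exp[OF w_pos, of "Binop Plus (cell 4) (Const 1)" m k] W(4) by simp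
  then have "eval w (root_guard k B) m = of_bool ((m 4 + 1) ^ k \<le> B * n)"
    using W assms(1) w_pos by (simp add: root_guard_def eval_low_cell less_Suc_eq_le)
  moreover have "(m 4 + 1) ^ k \<le> B * n \<longleftrightarrow> m 4 < q"
  proof
    assume "m 4 < q"
    then have "(m 4 + 1) ^ k \<le> q ^ k" by (intro power_mono) auto
    then show "(m 4 + 1) ^ k \<le> B * n" using root_le by simp
  next
    assume "(m 4 + 1) ^ k \<le> B * n"
    then show "m 4 < q" using root_less assms(2) by (cases "m 4 = q") auto
  qed
  ultimately show ?thesis by simp
qed

lemma ensures_root_loop:
  "ensures w S (q * 3 + 1) (root_loop k B) (start_memory n) (\<lambda>m. m = (start_memory n)(4 := q))"
proof -
  define I where "I i m \<longleftrightarrow> m = (start_memory n)(4 := i)" for i m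
  have cells: "m 0 = n" "m 4 = i" if "I i m" for i m
    using that by (simp_all add: I_def start_memory_def)
  have "ensures w S (q * (1 + 2) + 1) (root_loop k B) (start_memory n) (I q)"
    unfolding root_loop_def
  proof (rule ensures_While)
    show "I 0 (start_memory n)" by (auto simp: I_def start_memory_def)
    show "eval w (root_guard k B) m \<noteq> 0" if "i < q" "I i m" for i m
      using eval_root_guard[of m] cells[OF that(2)] that(1) by simp
    show "eval w (root_guard k B) m = 0" if "I q m" for m
      using eval_root_guard[of m] cells[OF that] by simp
    show "ensures w S 1 (Store (Const 4) (Binop Plus (cell 4) (Const 1))) m (I (Suc i))"
      if "i < q" "I i m" for i m
    proof (rule ensures_Store_cell)
      have "i + 1 < 2 ^ w" using that(1) small_less_word(3) by simp
      then show "I (Suc i) (m(4 := eval w (Binop Plus (cell 4) (Const 1)) m))"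
        using that(2) cells[OF that(2)] w_pos by (simp add: I_def eval_low_cell)
    qed simp
  qed
  then show ?thesis by (rule realizes_mono) (simp_all add: I_def)
qed

lemma eval_offset_exp:
  assumes "m 4 = q" "m 6 \<le> num_slots"
  shows "eval w (offset_exp k M) m = m 6 div (M * k) * q"
proof -
  have "m 6 div (M * k) \<le> num_slots div (M * k)" using assms(2) by (rule div_le_mono)
  also have "\<dots> = n div q + 1" using M_pos k_pos by (simp add: num_slots_def)
  finally show ?thesis
    using block_mult_less_word[of "m 6 div (M * k)"] assms(1) indices_less
    by (simp add: offset_exp_def eval_low_cell)
qed

lemma slot_block_less: "j < num_slots \<longleftrightarrow> j div (M * k) \<le> n div q"
  using M_pos k_pos by (simp add: num_slots_def div_less_iff_less_mult flip: less_Suc_eq_le)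

definition drawn :: "nat \<Rightarrow> (nat \<Rightarrow> nat) \<Rightarrow> memory \<Rightarrow> bool" where
  "drawn j \<rho> m \<longleftrightarrow> m 0 = n \<and> m 4 = q \<and> m 5 = 0 \<and> m 6 = j \<and> (\<forall>i<j. \<rho> i < q) \<and>
     (\<forall>i f. f < k + 2 \<longrightarrow> m (addr i f) = (if f = 0 \<and> i < j then i div (M * k) * q + \<rho> i else 0))"

lemma eval_draw_guard:
  assumes "drawn j \<rho> m" "j \<le> num_slots"
  shows "eval w (draw_guard k M) m = of_bool (j < num_slots)"
proof -
  have "eval w (offset_exp k M) m = j div (M * k) * q"
    using eval_offset_exp[of m] assms by (simp add: drawn_def)
  moreover have "eval w (cell 0) m = n" using assms(1) eval_low_cell[of 0] by (simp add: drawn_def)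
  ultimately show ?thesis
    using small_less_word(2) w_pos block_less_iff[of "j div (M * k)"] slot_block_less[of j]
    by (simp add: draw_guard_def)
qed

lemma drawn_Suc:
  assumes "drawn j \<rho> m" "y < q"
  shows "drawn (Suc j) (\<rho>(j := y)) (m(addr j 0 := j div (M * k) * q + y, 6 := j + 1))"
proof -
  let ?m = "m(addr j 0 := j div (M * k) * q + y, 6 := j + 1)"
  have low: "z \<noteq> addr i f" if "z < 8" for z i f using addr_ge[of i f] that by linarith
  have "?m (addr i f) = (if f = 0 \<and> i < Suc j then i div (M * k) * q + (\<rho>(j := y)) i else 0)"
    if f: "f < k + 2" for i f
  proof -
    have "addr i f = addr j 0 \<longleftrightarrow> i = j \<and> f = 0" using addr_eq_iff[OF f, of 0 i j] by simp
    moreover have "m (addr i f) = (if f = 0 \<and> i < j then i div (M * k) * q + \<rho> i else 0)"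
      using assms(1) f by (simp add: drawn_def)
    ultimately show ?thesis using low[of 6 i f] by (auto simp: less_Suc_eq)
  qed
  then show ?thesis using assms low[of _ j 0] by (simp add: drawn_def less_Suc_eq)
qed

lemma eval_current_record: "m 6 < num_slots \<Longrightarrow> eval w (record_exp k (cell 6) 0) m = addr (m 6) 0"
  using eval_record_exp[of "cell 6" m 0] by (simp add: eval_low_cell)

lemma ensures_shift_prog:
  assumes m: "drawn j \<rho> m" and j: "j < num_slots" and y: "y < q"
  shows "ensures w S 3 (shift_prog k M) (m(addr j 0 := y)) (drawn (Suc j) (\<rho>(j := y)))"
proof -
  let ?e = "record_exp k (cell 6) 0"
  let ?v = "Binop Plus (Load ?e) (offset_exp k M)"
  define m1 where "m1 = m(addr j 0 := y)"
  define m2 where "m2 = m1(addr j 0 := j div (M * k) * q + y)"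
  have "z \<noteq> addr j 0" if "z < 8" for z using addr_ge[of j 0] that by linarith
  then have m1: "m1 4 = q" "m1 6 = j" "m1 (addr j 0) = y" "m2 6 = j"
    using m by (simp_all add: m1_def m2_def drawn_def)
  have "j div (M * k) * q < n + 1" using j block_less_iff slot_block_less by blast
  then have "j div (M * k) * q + y < 2 ^ w" using y small_less_word(3) by linarith
  then have "eval w ?v m1 = j div (M * k) * q + y"
    using eval_offset_exp[of m1] eval_current_record[of m1] m1 j by (simp add: add.commute)
  moreover have "addr j 0 < S" using j by (intro addr_less) auto
  ultimately have store: "ensures w S 1 (Store ?e ?v) m1 (\<lambda>m'. m' = m2)"
    using eval_current_record[of m1] j by (intro ensures_Store) (simp_all only: m1(2) m2_def)
  have "j + 1 < 2 ^ w" using j num_slots_less by simp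
  then have "eval w (Binop Plus (cell 6) (Const 1)) m2 = j + 1"
    using m1(4) w_pos by (simp add: eval_low_cell)
  moreover have "drawn (Suc j) (\<rho>(j := y)) (m2(6 := j + 1))"
    using drawn_Suc[OF m y] by (simp only: m1_def m2_def fun_upd_upd)
  ultimately have "ensures w S 1 (Store (Const 6) (Binop Plus (cell 6) (Const 1))) m2
      (drawn (Suc j) (\<rho>(j := y)))"
    by (intro ensures_Store_cell) simp_all
  then have "ensures w S (1 + 1 + 1) (shift_prog k M) m1 (drawn (Suc j) (\<rho>(j := y)))"
    unfolding shift_prog_def by (intro ensures_Seq[OF store]) simp
  then show ?thesis by (simp add: m1_def numeral_3_eq_3)
qed

lemma realizes_draw_body:
  assumes m: "drawn j \<rho> m" and j: "j < num_slots"
  shows "realizes w S 5 (draw_body k M) m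
    (map_pmf (\<lambda>y. \<rho>(j := y)) (pmf_of_set {..<q})) (drawn (Suc j))"
proof -
  let ?e = "record_exp k (cell 6) 0"
  define R where "R \<rho>' m' \<longleftrightarrow> (\<exists>y<q. \<rho>' = \<rho>(j := y) \<and> m' = m(addr j 0 := y))" for \<rho>' m'
  have cells: "m 4 = q" "m 6 = j" using m by (auto simp: drawn_def)
  have "eval w (Binop Minus (cell 4) (Const 1)) m = q - 1"
    using small_less_word(3) w_pos by (simp add: eval_low_cell cells)
  moreover have "{..q - 1} = {..<q}" using q_pos by auto
  moreover have "addr j 0 < S" using j by (intro addr_less) auto
  ultimately have draw: "realizes w S 1 (Rand ?e (Binop Minus (cell 4) (Const 1))) m
      (map_pmf (\<lambda>y. \<rho>(j := y)) (pmf_of_set {..<q})) R"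
    using realizes_Rand[of w ?e m S "Binop Minus (cell 4) (Const 1)" R "\<lambda>y. \<rho>(j := y)"] q_pos
      eval_current_record[of m] j by (force simp: cells R_def)
  have shift: "realizes w S 3 (shift_prog k M) m' (return_pmf \<rho>') (drawn (Suc j))"
    if "R \<rho>' m'" for \<rho>' m'
    using that ensures_shift_prog[OF m j] by (subst realizes_return_pmf) (auto simp: R_def)
  have "realizes w S (1 + 3 + 1) (draw_body k M) m
      (bind_pmf (map_pmf (\<lambda>y. \<rho>(j := y)) (pmf_of_set {..<q})) return_pmf) (drawn (Suc j))"
    unfolding draw_body_def by (rule realizes_Seq[OF draw shift])
  then show ?thesis by (simp add: bind_return_pmf')
qed

lemma drawn_tracks:
  assumes "drawn num_slots \<rho> m"
  shows "tracks (sample \<rho>) {} m"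
proof -
  have "sample \<rho> i a div q = i \<and> (\<forall>f<k + 2. m (addr (slot i a) f) = content (sample \<rho>) {} i a f)"
    if ia: "i \<le> n div q" "a < M * k" for i a
  proof -
    have "slot i a div (M * k) = i" using ia(2) M_pos k_pos unfolding slot_def by (subst div_mult_self3) auto
    then show ?thesis
      using assms slot_less[OF ia] by (auto simp: drawn_def sample_def content_def)
  qed
  then show ?thesis
    using assms unfolding tracks_def represents_def by (auto simp: drawn_def arcs_def)
qed

lemma realizes_setup_prog:
  "realizes w S (q * 3 + 1 + (num_slots * 7 + 1) + 1) (setup_prog k M B) (start_memory n)
     samples (\<lambda>x. tracks x {})"
proof -
  let ?f = "\<lambda>j \<rho>. map_pmf (\<lambda>y. \<rho>(j := y)) (pmf_of_set {..<q})"
  have "((start_memory n)(4 := q)) (addr i f) = 0" for i f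
    using addr_ge[of i f] by (auto simp: start_memory_def)
  then have start: "drawn 0 (\<lambda>_. 0) ((start_memory n)(4 := q))"
    by (simp add: drawn_def) (simp add: start_memory_def)
  have "realizes w S (num_slots * (5 + 2) + 1) (While (draw_guard k M) (draw_body k M))
      ((start_memory n)(4 := q)) (iterate_pmf ?f num_slots (\<lambda>_. 0)) (drawn num_slots)"
    using eval_draw_guard realizes_draw_body
    by (intro realizes_While[where R = drawn and f = ?f]) (auto intro: start)
  then have draw: "realizes w S (num_slots * 7 + 1) (While (draw_guard k M) (draw_body k M))
      ((start_memory n)(4 := q)) draws (\<lambda>\<rho>. tracks (sample \<rho>) {})"
    unfolding iterate_pmf_Pi_pmf draws_def using drawn_tracks by (elim realizes_mono) simp_all
  have "realizes w S (q * 3 + 1 + (num_slots * 7 + 1) + 1) (setup_prog k M B) (start_memory n)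
      (bind_pmf (return_pmf ()) (\<lambda>_. draws)) (\<lambda>\<rho>. tracks (sample \<rho>) {})"
    unfolding setup_prog_def using draw by (intro realizes_Seq[OF ensures_root_loop]) simp
  then show ?thesis by (simp add: bind_return_pmf samples_def realizes_def pmf.rel_map)
qed

end

section \<open>Correctness of the tester\<close>

context tester
begin

abbreviation alg :: stream_alg where
  "alg \<equiv> tester_alg f k M B"

lemma word_size_tester: "word_size alg n = w"
  by (simp add: word_size_def tester_alg_def word_length)

lemma memory_after_tracks:
  assumes "valid_stream n xs"
  shows "rel_pmf (\<lambda>x. tracks x (stream_graph xs)) samples (memory_after alg S n xs)"
  using assms
proof (induction xs rule: rev_induct)
  case Nil
  show ?case
    using realizes_outcome[OF realizes_setup_prog]
    by (simp add: memory_after_def word_size_tester stream_graph_def) (simp add: tester_alg_def)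
next
  case (snoc e xs)
  define E where "E = stream_graph xs"
  have xs: "valid_stream n xs" and e: "valid_stream_from n E [e]"
    using snoc.prems unfolding valid_stream_snoc E_def by auto
  have update: "rel_pmf (\<lambda>x. tracks x (apply_update e E)) (return_pmf x)
      (outcome w S (edge_prog k M) (feed e m))" if "tracks x E m" for x m
    using realizes_outcome[OF ensures_edge_prog[OF that _ e]] stream_graph_subset[OF xs]
    by (simp add: E_def rel_pmf_return_pmf1)
  have "rel_pmf (\<lambda>x. tracks x (apply_update e E)) (bind_pmf samples return_pmf)
      (bind_pmf (memory_after alg S n xs) (\<lambda>m. outcome w S (edge_prog k M) (feed e m)))"
    using snoc.IH[OF xs] update unfolding E_def by (rule rel_pmf_bindI)
  then show ?case
    by (simp add: memory_after_def word_size_tester bind_return_pmf' stream_graph_snoc E_def)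
      (simp add: tester_alg_def)
qed

lemma memory_after_support:
  assumes "valid_stream n xs" "m \<in> set_pmf (memory_after alg S n xs)"
  obtains x where "tracks x (stream_graph xs) m"
  using rel_setD2[OF rel_pmf_imp_rel_set[OF memory_after_tracks[OF assms(1)]] assms(2)] by blast

lemma ensures_verdict:
  assumes "valid_stream n xs" "tracks x (stream_graph xs) m"
  shows "ensures w S (5 * (n div q) + 20) (verdict_prog k M) m (\<lambda>m'. m' 0 \<noteq> 0 \<longleftrightarrow>
    \<not> (card (stream_graph xs) + 1 < n \<or> (\<exists>i\<le>n div q. detects x (arcs (stream_graph xs)) i)))"
  using ensures_verdict_prog[of x "arcs (stream_graph xs)" m] assms(2)
    card_edges_le[OF stream_graph_subset[OF assms(1)]]
  by (simp add: tracks_def)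

lemma runs_within_tester: "runs_within alg n S (5 * (n div q) + 20)"
  unfolding runs_within_def word_size_tester
proof (intro conjI allI impI ballI)
  show "4 \<le> S" using memory_size by simp
  show "0 < word_factor alg" using w_pos word_length by (simp add: tester_alg_def)
  show "\<exists>t. halts_within w S t (init_prog alg) (start_memory n)"
    using realizes_halts[OF realizes_setup_prog] by (auto simp: tester_alg_def)
next
  fix xs e m assume xs: "valid_stream n (xs @ [e])" and m: "m \<in> set_pmf (memory_after alg S n xs)"
  then have v: "valid_stream n xs" and e: "valid_stream_from n (stream_graph xs) [e]"
    unfolding valid_stream_snoc by auto
  obtain x where "tracks x (stream_graph xs) m" using memory_after_support[OF v m] .
  from realizes_halts[OF ensures_edge_prog[OF this stream_graph_subset[OF v] e]]
  show "\<exists>t. halts_within w S t (update_prog alg) (feed e m)"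
    by (auto simp: tester_alg_def)
next
  fix xs m assume xs: "valid_stream n xs" and m: "m \<in> set_pmf (memory_after alg S n xs)"
  obtain x where "tracks x (stream_graph xs) m" using memory_after_support[OF xs m] .
  from realizes_halts[OF ensures_verdict[OF xs this]]
  show "halts_within w S (5 * (n div q) + 20) (post_prog alg) m" by (simp add: tester_alg_def)
qed

lemma verdict_tester:
  assumes xs: "valid_stream n xs" and E: "E = stream_graph xs"
  shows "verdict alg S n xs =
    map_pmf (\<lambda>x. \<not> (card E + 1 < n \<or> (\<exists>i\<le>n div q. detects x (arcs E) i))) samples"
proof -
  let ?acc = "\<lambda>x. \<not> (card E + 1 < n \<or> (\<exists>i\<le>n div q. detects x (arcs E) i))"
  have "rel_pmf (\<lambda>x b. ?acc x = b) (return_pmf x)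
      (map_pmf (\<lambda>m'. m' 0 \<noteq> 0) (outcome w S (verdict_prog k M) m))" if "tracks x E m" for x m
    using realizes_outcome[OF ensures_verdict[OF xs that[unfolded E]]]
    by (auto simp: rel_pmf_return_pmf1 E)
  then have "rel_pmf (\<lambda>x b. ?acc x = b) (bind_pmf samples return_pmf) (verdict alg S n xs)"
    using memory_after_tracks[OF xs] unfolding verdict_def word_size_tester E[symmetric]
    by (auto simp: tester_alg_def intro: rel_pmf_bindI)
  then have "rel_pmf (=) (map_pmf ?acc samples) (verdict alg S n xs)"
    by (simp add: bind_return_pmf' pmf.rel_map)
  then show ?thesis by (simp only: pmf.rel_eq)
qed

lemma tester_accepts_connected:
  assumes xs: "valid_stream n xs" and conn: "connected_graph n (stream_graph xs)"
  shows "pmf (verdict alg S n xs) True = 1"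
proof -
  define E where "E = stream_graph xs"
  have E: "E \<subseteq> edges_on n" unfolding E_def using xs by (rule stream_graph_subset)
  have "n \<le> card E + 1" using connected_graph_card_edges[OF _ E] conn by (simp add: E_def)
  moreover have "\<not> detects x (arcs E) i" for x i
    using detects_imp_not_connected[OF _ E] conn unfolding E_def by blast
  ultimately have "verdict alg S n xs = map_pmf (\<lambda>_. True) samples"
    using verdict_tester[OF xs E_def] by simp
  then show ?thesis by simp
qed

lemma tester_rejects_far:
  assumes xs: "valid_stream n xs" and far: "far_from connected_graph \<epsilon> n (stream_graph xs)"
    and \<epsilon>: "0 < \<epsilon>" and q: "16 * k * k \<le> q"
    and large: "16 / 5 * real k * real q ^ k \<le> real M * (((real k + 1) * \<epsilon> - 1) * real n)"
  shows "2 / 3 \<le> pmf (verdict alg S n xs) False"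
proof -
  define E where "E = stream_graph xs"
  have E: "E \<subseteq> edges_on n" unfolding E_def using xs by (rule stream_graph_subset)
  have pmf: "pmf (verdict alg S n xs) False =
      measure_pmf.prob samples {x. card E + 1 < n \<or> (\<exists>i\<le>n div q. detects x (arcs E) i)}"
    unfolding verdict_tester[OF xs E_def] pmf_map by (simp add: vimage_def)
  show ?thesis
  proof (cases "card E + 1 < n")
    case True
    then show ?thesis unfolding pmf by simp
  next
    case False
    have "real k * (16 / 5 * real q ^ k) \<le> real M * (((real k + 1) * \<epsilon> - 1) * real n)"
      using large by (simp add: mult_ac)
    also have "\<dots> \<le> real M * (real k * real (card {C \<in> graph_components n E. card C \<le> k}))"
      using many_small_components[OF far[folded E_def] E _ _ \<epsilon>, of k] False n_pos
      by (intro mult_left_mono) simp_all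
    finally have "real k * (16 / 5 * real q ^ k) \<le>
        real k * (real M * real (card {C \<in> graph_components n E. card C \<le> k}))"
      by (simp add: mult_ac)
    then have "16 / 5 * real q ^ k \<le> real M * real (card {C \<in> graph_components n E. card C \<le> k})"
      using k_pos by (simp add: mult_le_cancel_left_pos)
    moreover have "\<not> connected_graph n E"
      using far_from_not_connected[OF far _ less_imp_le[OF \<epsilon>]] E unfolding E_def by blast
    ultimately show ?thesis unfolding pmf using prob_detects_ge[OF E _ q] False by simp
  qed
qed

end

section \<open>Space and time\<close>

text \<open>The factor makes the block length at least \<open>16 * k * k\<close>, so that strays are rare.\<close>

definition root_bound :: "nat \<Rightarrow> nat" where
  "root_bound k = (16 * k * k) ^ k"

definition block_length :: "nat \<Rightarrow> nat \<Rightarrow> nat" where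
  "block_length k n = (LEAST q. root_bound k * n < (q + 1) ^ k)"

lemma root_bound_pos: "0 < k \<Longrightarrow> 0 < root_bound k"
  by (simp add: root_bound_def)

lemma less_block_length_power:
  assumes "0 < k"
  shows "root_bound k * n < (block_length k n + 1) ^ k"
proof -
  have "root_bound k * n + 1 \<le> (root_bound k * n + 1) ^ k"
    using power_increasing[of 1 k "root_bound k * n + 1"] assms by simp
  then have "root_bound k * n < (root_bound k * n + 1) ^ k" by linarith
  then show ?thesis unfolding block_length_def by (rule LeastI)
qed

lemma block_length_ge:
  assumes "0 < k" "0 < n"
  shows "16 * k * k \<le> block_length k n"
proof (rule ccontr)
  assume "\<not> 16 * k * k \<le> block_length k n"
  then have "(block_length k n + 1) ^ k \<le> root_bound k"
    unfolding root_bound_def by (intro power_mono) auto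
  also have "\<dots> \<le> root_bound k * n" using assms(2) by simp
  finally show False using less_block_length_power[OF assms(1), of n] by simp
qed

lemma block_length_pos: "0 < k \<Longrightarrow> 0 < n \<Longrightarrow> 0 < block_length k n"
  using block_length_ge[of k n] by (cases "block_length k n") auto

lemma block_length_power_le:
  assumes "0 < k" "0 < n"
  shows "block_length k n ^ k \<le> root_bound k * n"
  using not_less_Least[of "block_length k n - 1" "\<lambda>q. root_bound k * n < (q + 1) ^ k"]
    block_length_pos[OF assms]
  unfolding block_length_def[symmetric] by simp

lemma blocks_le:
  assumes "0 < k" "0 < n"
  shows "real (n div block_length k n) \<le> 2 * real n powr (1 - 1 / real k)"
proof -
  let ?q = "block_length k n"
  have q: "1 \<le> ?q" using block_length_pos[OF assms] by simp
  have "1 * n \<le> root_bound k * n"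
    using root_bound_pos[OF assms(1)] by (intro mult_le_mono1) simp
  then have "real n \<le> real ((?q + 1) ^ k)"
    using less_block_length_power[OF assms(1), of n] by (intro of_nat_mono) linarith
  also have "\<dots> = (real ?q + 1) powr real k" by (simp add: powr_realpow add.commute)
  finally have "real n powr (1 / real k) \<le> ((real ?q + 1) powr real k) powr (1 / real k)"
    by (intro powr_mono2) auto
  also have "\<dots> = real ?q + 1" using assms(1) by (simp add: powr_powr)
  also have "\<dots> \<le> 2 * real ?q" using q by simp
  finally have root: "real n powr (1 / real k) \<le> 2 * real ?q" .
  have "real (n div ?q) \<le> real n / real ?q" by (rule of_nat_div_le_of_nat)
  also have "real n = real n powr (1 - 1 / real k) * real n powr (1 / real k)"
    using assms(2) by (simp add: powr_add[symmetric])
  also have "\<dots> / real ?q \<le> real n powr (1 - 1 / real k) * (2 * real ?q) / real ?q"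
    using root by (intro divide_right_mono mult_left_mono) auto
  also have "\<dots> = 2 * real n powr (1 - 1 / real k)" using q by simp
  finally show ?thesis .
qed

definition space_words :: "nat \<Rightarrow> nat \<Rightarrow> nat \<Rightarrow> nat" where
  "space_words k M n = 8 + (n div block_length k n + 1) * (M * k) * (k + 2)"

definition word_const :: "nat \<Rightarrow> nat \<Rightarrow> nat" where
  "word_const k M = 30 + M * k * (k + 2) + k + 2 * root_bound k + 2 ^ k * root_bound k"

lemma const_mult_square_less:
  assumes "0 < n"
  shows "c * (n + 1)\<^sup>2 < 2 ^ ((c + 2) * floorlog 2 n)"
proof -
  let ?L = "floorlog 2 n"
  have L: "1 \<le> ?L" using assms by (simp add: floorlog_def)
  have "n + 1 \<le> 2 ^ ?L" using floorlog_bounds[of n 2] assms by simp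
  then have "(n + 1)\<^sup>2 \<le> (2 ^ ?L)\<^sup>2" by (rule power_mono) simp
  then have "c * (n + 1)\<^sup>2 \<le> c * (2 ^ ?L)\<^sup>2" by (rule mult_le_mono2)
  also have "\<dots> < 2 ^ c * (2 ^ ?L)\<^sup>2" by (intro mult_strict_right_mono less_exp) simp
  also have "\<dots> = 2 ^ (c + 2 * ?L)" by (simp add: power_add power_mult[symmetric] mult.commute)
  also have "\<dots> \<le> 2 ^ ((c + 2) * ?L)"
  proof (rule power_increasing)
    have "c * 1 \<le> c * ?L" using L by (rule mult_le_mono2)
    then show "c + 2 * ?L \<le> (c + 2) * ?L" by (simp add: algebra_simps)
  qed simp
  finally show ?thesis .
qed

lemma tester_block_length:
  assumes k: "0 < k" and M: "0 < M" and n: "0 < n"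
  shows "tester n (block_length k n) k M ((word_const k M + 2) * floorlog 2 n) (space_words k M n)
    (root_bound k) (word_const k M + 2)"
proof -
  let ?q = "block_length k n" and ?B = "root_bound k" and ?A = "M * k * (k + 2)"
  let ?P = "(n + 1)\<^sup>2" and ?w = "(word_const k M + 2) * floorlog 2 n"
  interpret block_sampling n ?q k M using block_length_pos[OF k n] by unfold_locales
  have "30 * ?P + ?A * ?P + k * ?P + 2 * (?B * ?P) + 2 ^ k * ?B * ?P < 2 ^ ?w"
    using const_mult_square_less[OF n, of "word_const k M"]
    by (simp add: word_const_def algebra_simps)
  then have word: "30 * ?P + ?A * ?P + k * ?P + 2 * (?B * ?P) + 2 ^ k * (?B * ?P) < 2 ^ ?w"
    by (simp add: mult.assoc)
  have P: "1 \<le> ?P" "n + 1 \<le> ?P" "2 * n * n + 4 * n \<le> 4 * ?P" by (auto simp: power2_eq_square)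
  have kP: "k \<le> k * ?P" "?B \<le> ?B * ?P" using P(1) by simp_all
  have qk: "?q ^ k \<le> ?B * ?P" using block_length_power_le[OF k n] P(2) by (meson add_leD1 le_trans mult_le_mono2)
  have "?q \<le> ?q ^ k" using power_increasing[of 1 k ?q] k q_pos by simp
  then have values_word: "2 * n * n + 4 * n + ?q + k + 8 < 2 ^ ?w" using word kP P qk by linarith
  have "(?q + 1) ^ k \<le> (2 * ?q) ^ k" using q_pos by (intro power_mono) auto
  also have "\<dots> = 2 ^ k * ?q ^ k" by (rule power_mult_distrib)
  also have "\<dots> \<le> 2 ^ k * (?B * ?P)" using qk by (rule mult_le_mono2)
  finally have root_word: "(?q + 1) ^ k + ?B + 1 < 2 ^ ?w" using word kP P by linarith
  have "n div ?q + 1 \<le> ?P" using div_le_dividend[of n ?q] P(2) by linarith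
  then have "(n div ?q + 1) * ?A \<le> ?P * ?A" by (rule mult_le_mono1)
  then have "space_words k M n \<le> 8 + ?A * ?P" by (simp only: space_words_def mult_ac add_left_mono)
  then have "space_words k M n < 2 ^ ?w" using word P by linarith
  then show ?thesis
    using k M n values_word root_word block_length_power_le[OF k n] less_block_length_power[OF k, of n]
    by unfold_locales (simp_all add: space_words_def num_slots_def)
qed

text \<open>Components of size up to \<open>1 / \<epsilon>\<close> are searched for. The number of groups makes the expected number
  of catches at least 3.\<close>

definition component_bound :: "real \<Rightarrow> nat" where
  "component_bound \<epsilon> = max 1 (nat \<lfloor>1 / \<epsilon>\<rfloor>)"

definition num_groups :: "real \<Rightarrow> nat" where
  "num_groups \<epsilon> = (let k = component_bound \<epsilon> in
     nat \<lceil>16 / 5 * real k * real (root_bound k) / ((real k + 1) * \<epsilon> - 1)\<rceil> + 1)"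

definition connectivity_tester :: "real \<Rightarrow> stream_alg" where
  "connectivity_tester \<epsilon> = (let k = component_bound \<epsilon>; M = num_groups \<epsilon> in
     tester_alg (word_const k M + 2) k M (root_bound k))"

definition tester_space :: "real \<Rightarrow> nat \<Rightarrow> nat" where
  "tester_space \<epsilon> = space_words (component_bound \<epsilon>) (num_groups \<epsilon>)"

definition tester_time :: "real \<Rightarrow> nat \<Rightarrow> nat" where
  "tester_time \<epsilon> n = 5 * (n div block_length (component_bound \<epsilon>) n) + 20"

lemma component_bound_pos: "0 < component_bound \<epsilon>"
  by (simp add: component_bound_def)

lemma component_bound_gap:
  assumes "0 < \<epsilon>"
  shows "0 < (real (component_bound \<epsilon>) + 1) * \<epsilon> - 1"
proof -
  have "1 / \<epsilon> < real (component_bound \<epsilon>) + 1" unfolding component_bound_def by linarith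
  then show ?thesis using assms by (simp add: field_simps)
qed

lemma powr_component_bound_le:
  assumes "0 < \<epsilon>" "0 < n"
  shows "real n powr (1 - 1 / real (component_bound \<epsilon>)) \<le> max 1 (real n powr (1 - \<epsilon>))"
proof (cases "component_bound \<epsilon> = 1")
  case False
  then have "real (component_bound \<epsilon>) = of_int \<lfloor>1 / \<epsilon>\<rfloor>"
    by (auto simp: component_bound_def max_def split: if_splits)
  then have "real (component_bound \<epsilon>) \<le> 1 / \<epsilon>" by linarith
  then have "\<epsilon> \<le> 1 / real (component_bound \<epsilon>)"
    using assms(1) component_bound_pos[of \<epsilon>] by (simp add: field_simps)
  then have "real n powr (1 - 1 / real (component_bound \<epsilon>)) \<le> real n powr (1 - \<epsilon>)"
    using assms(2) by (intro powr_mono) auto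
  then show ?thesis by simp
qed simp

lemma num_groups_large:
  assumes "0 < \<epsilon>" "0 < n"
  defines "k \<equiv> component_bound \<epsilon>"
  shows "16 / 5 * real k * real (block_length k n) ^ k \<le>
    real (num_groups \<epsilon>) * (((real k + 1) * \<epsilon> - 1) * real n)"
proof -
  let ?\<delta> = "(real k + 1) * \<epsilon> - 1"
  have "real (block_length k n ^ k) \<le> real (root_bound k * n)"
    using block_length_power_le[OF component_bound_pos assms(2)] unfolding k_def
    by (rule of_nat_mono)
  then have "16 / 5 * real k * real (block_length k n) ^ k \<le>
      16 / 5 * real k * (real (root_bound k) * real n)"
    by (intro mult_left_mono) auto
  also have "\<dots> = 16 / 5 * real k * real (root_bound k) * real n" by simp
  also have "16 / 5 * real k * real (root_bound k) / ?\<delta> \<le> real (num_groups \<epsilon>)"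
    unfolding num_groups_def k_def Let_def by linarith
  then have "16 / 5 * real k * real (root_bound k) \<le> real (num_groups \<epsilon>) * ?\<delta>"
    using component_bound_gap[OF assms(1)] unfolding k_def by (simp add: field_simps)
  then have "16 / 5 * real k * real (root_bound k) * real n \<le> real (num_groups \<epsilon>) * ?\<delta> * real n"
    by (rule mult_right_mono) simp
  finally show ?thesis by (simp add: mult.assoc)
qed

lemma connectivity_tester_correct:
  assumes "0 < \<epsilon>"
  shows "dynamic_streaming_tester connected_graph \<epsilon>
    (connectivity_tester \<epsilon>) (tester_space \<epsilon>) (tester_time \<epsilon>)"
  unfolding dynamic_streaming_tester_def
proof (intro allI impI)
  fix n :: nat assume "1 \<le> n"
  then have n: "0 < n" by simp
  let ?k = "component_bound \<epsilon>" and ?M = "num_groups \<epsilon>"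
  interpret tester n "block_length ?k n" ?k ?M "(word_const ?k ?M + 2) * floorlog 2 n"
      "space_words ?k ?M n" "root_bound ?k" "word_const ?k ?M + 2"
    using tester_block_length[OF component_bound_pos _ n] by (simp add: num_groups_def Let_def)
  show "runs_within (connectivity_tester \<epsilon>) n (tester_space \<epsilon> n) (tester_time \<epsilon> n) \<and>
    (\<forall>xs. valid_stream n xs \<longrightarrow>
      (connected_graph n (stream_graph xs) \<longrightarrow>
        2 / 3 \<le> pmf (verdict (connectivity_tester \<epsilon>) (tester_space \<epsilon> n) n xs) True) \<and>
      (far_from connected_graph \<epsilon> n (stream_graph xs) \<longrightarrow>
        2 / 3 \<le> pmf (verdict (connectivity_tester \<epsilon>) (tester_space \<epsilon> n) n xs) False))"
    using runs_within_tester tester_accepts_connected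
      tester_rejects_far[OF _ _ assms block_length_ge[OF component_bound_pos n]
        num_groups_large[OF assms n]]
    by (simp add: connectivity_tester_def tester_space_def tester_time_def Let_def)
qed

lemma tester_blocks_le:
  assumes "0 < \<epsilon>" "0 < n"
  shows "real (n div block_length (component_bound \<epsilon>) n) \<le> 2 * max 1 (real n powr (1 - \<epsilon>))"
  using blocks_le[OF component_bound_pos assms(2), of \<epsilon>] powr_component_bound_le[OF assms]
  by linarith

lemma floorlog_le_ln:
  assumes "3 \<le> n"
  shows "real (floorlog 2 n) \<le> (1 / ln 2 + 1) * ln (real n)"
proof -
  have "exp 1 \<le> real n" using exp_le assms by linarith
  then have "1 \<le> ln (real n)" using assms by (simp add: ln_ge_iff)
  moreover have "real (floorlog 2 n) \<le> log 2 (real n) + 1" using assms by (simp add: floorlog_def)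
  ultimately show ?thesis by (simp add: log_def algebra_simps)
qed

lemma soft_O_I:
  assumes "\<And>n. N \<le> n \<Longrightarrow> \<bar>f n\<bar> \<le> c * (g n * ln (real n) ^ j)"
  shows "f \<in> soft_O g"
proof -
  have "f \<in> O(\<lambda>n. g n * ln (real n) ^ j)"
  proof (rule bigoI[where c = "\<bar>c\<bar>"])
    show "\<forall>\<^sub>F n in sequentially. norm (f n) \<le> \<bar>c\<bar> * norm (g n * ln (real n) ^ j)"
      using eventually_ge_at_top[of N]
    proof eventually_elim
      case (elim n)
      then have "\<bar>f n\<bar> \<le> \<bar>c * (g n * ln (real n) ^ j)\<bar>" using assms[of n] by linarith
      then show ?case by (simp add: abs_mult)
    qed
  qed
  then show ?thesis unfolding soft_O_def by blast
qed

lemma tester_time_soft_O: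
  assumes "0 < \<epsilon>"
  shows "(\<lambda>n. real (tester_time \<epsilon> n)) \<in> soft_O (\<lambda>n. max 1 (real n powr (1 - \<epsilon>)))"
proof (rule soft_O_I[where N = 1 and c = 30 and j = 0])
  fix n :: nat assume "1 \<le> n"
  then show "\<bar>real (tester_time \<epsilon> n)\<bar> \<le> 30 * (max 1 (real n powr (1 - \<epsilon>)) * ln (real n) ^ 0)"
    using tester_blocks_le[OF assms, of n] by (simp add: tester_time_def)
qed

lemma tester_space_le:
  assumes "0 < \<epsilon>" "0 < n"
  defines "k \<equiv> component_bound \<epsilon>"
  shows "real (tester_space \<epsilon> n) \<le>
    (8 + 3 * real (num_groups \<epsilon> * k * (k + 2))) * max 1 (real n powr (1 - \<epsilon>))"
proof -
  let ?a = "real (num_groups \<epsilon> * k * (k + 2))" and ?g = "max 1 (real n powr (1 - \<epsilon>))"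
  have "real (tester_space \<epsilon> n) = 8 + (real (n div block_length k n) + 1) * ?a"
    by (simp add: tester_space_def space_words_def k_def algebra_simps)
  also have "\<dots> \<le> 8 * ?g + (2 * ?g + ?g) * ?a"
    using tester_blocks_le[OF assms(1,2)] unfolding k_def by (intro add_mono mult_right_mono) auto
  also have "\<dots> = (8 + 3 * ?a) * ?g" by (simp add: algebra_simps)
  finally show ?thesis .
qed

lemma tester_space_soft_O:
  assumes "0 < \<epsilon>"
  shows "(\<lambda>n. real (space_bits (connectivity_tester \<epsilon>) (tester_space \<epsilon>) n))
    \<in> soft_O (\<lambda>n. max 1 (real n powr (1 - \<epsilon>)))"
proof -
  define f where "f = real (word_factor (connectivity_tester \<epsilon>))"
  define a where "a = 8 + 3 * real (num_groups \<epsilon> * component_bound \<epsilon> * (component_bound \<epsilon> + 2))"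
  let ?g = "\<lambda>n :: nat. max 1 (real n powr (1 - \<epsilon>))"
  show ?thesis
  proof (rule soft_O_I[where N = 3 and c = "a * (f * (1 / ln 2 + 1))" and j = 1])
    fix n :: nat assume n: "3 \<le> n"
    have "real (space_bits (connectivity_tester \<epsilon>) (tester_space \<epsilon>) n) =
        real (tester_space \<epsilon> n) * (f * real (floorlog 2 n))"
      by (simp add: space_bits_def word_size_def f_def)
    also have "\<dots> \<le> (a * ?g n) * (f * ((1 / ln 2 + 1) * ln (real n)))"
      using tester_space_le[OF assms, of n] floorlog_le_ln[OF n] n
      by (intro mult_mono) (auto simp: a_def f_def)
    finally show "\<bar>real (space_bits (connectivity_tester \<epsilon>) (tester_space \<epsilon>) n)\<bar> \<le>
        a * (f * (1 / ln 2 + 1)) * (?g n * ln (real n) ^ 1)"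
      by (simp add: mult_ac)
  qed
qed

theorem theorem4p1:
  fixes \<epsilon> :: real
  assumes "\<epsilon> > 0"
  shows "\<exists>A S T. dynamic_streaming_tester connected_graph \<epsilon> A S T \<and>
           (\<lambda>n. real (space_bits A S n)) \<in> soft_O (\<lambda>n. max 1 (real n powr (1 - \<epsilon>))) \<and>
           (\<lambda>n. real (T n)) \<in> soft_O (\<lambda>n. max 1 (real n powr (1 - \<epsilon>)))"
  using connectivity_tester_correct[OF assms] tester_space_soft_O[OF assms] tester_time_soft_O[OF assms]
  by blast

end
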